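(* For every $k\in(0,1)$ there is a set $S$ of rational primes, with both $S$ and its complement $\mathbb P\setminus S$ in the set $\mathbb P$ of rational primes infinite, such that $$\mathsf M_S(N)\sim k\log N\qquad (N\to\infty).$$
   Context: $\mathbb P$ is the set of rational primes and $|\cdot|_p$ is the $p$-adic absolute value on $\mathbb Q$ with $|p|_p=p^{-1}$. For $S\subseteq\mathbb P$ let $R_S=\{r\in\mathbb Q: |r|_p\le 1\text{ for all }p\in\mathbb P\setminus S\}$, and let $T_S$ be the continuous endomorphism of the compact dual group $\widehat{R_S}$ dual to $r\mapsto 2r$ on the discrete group $R_S$. A closed orbit $\tau$ of length $|\tau|=n$ is a set $\{x,T_S(x),\dots,T_S^n(x)=x\}$ of cardinality $n$. Define $\mathsf M_S(N)=\sum_{|\tau|\le N}e^{-h|\tau|}$, the sum over closed orbits of $T_S$ of length at most $N$, where $h=h(T_S)$ is the topological entropy. It is known that $h(T_S)=\log 2$ and that the number of points with $T_S^nx=x$ is $(2^n-1)\prod_{p\in S}|2^n-1|_p$, so that, with $|x|_S=\prod_{p\in S}|x|_p$ and $\mu$ the Möbius function, $$\mathsf M_S(N)=\sum_{n\le N}\frac1{n2^n}\sum_{d\mid n}\mu(n/d)\,(2^d-1)\,|2^d-1|_S .$$ *)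

theory Defs
  imports "HOL-Analysis.Analysis" "HOL-Computational_Algebra.Primes" "HOL-Library.Landau_Symbols"
begin

definition padic_abs :: "nat \<Rightarrow> rat \<Rightarrow> real" where
  "padic_abs p r = (if r = 0 then 0 else
     (case quotient_of r of (a, b) \<Rightarrow>
        real p powi (int (multiplicity (int p) b) - int (multiplicity (int p) a))))"

definition S_integers :: "nat set \<Rightarrow> rat set" where
  "S_integers S = {r. \<forall>p. prime p \<and> p \<notin> S \<longrightarrow> padic_abs p r \<le> 1}"

(* Unitary characters of a discrete additive group with carrier G; they are made extensional, so
   that a character is determined by its values on G.  No continuity condition is needed, since
   G is discrete. *)
definition unitary_characters :: "'a::ab_group_add set \<Rightarrow> ('a \<Rightarrow> complex) set" where
  "unitary_characters G =
     {\<xi> \<in> extensional G. (\<forall>x\<in>G. norm (\<xi> x) = 1) \<and> (\<forall>x\<in>G. \<forall>y\<in>G. \<xi> (x + y) = \<xi> x * \<xi> y)}"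

(* The compact-open topology on the dual of a discrete group is the topology of pointwise
   convergence. *)
definition dual_space :: "'a::ab_group_add set \<Rightarrow> ('a \<Rightarrow> complex) topology" where
  "dual_space G = subtopology (product_topology (\<lambda>_. euclidean) G) (unitary_characters G)"

definition dual_map :: "'a set \<Rightarrow> ('a \<Rightarrow> 'a) \<Rightarrow> ('a \<Rightarrow> complex) \<Rightarrow> ('a \<Rightarrow> complex)" where
  "dual_map G \<phi> \<xi> = (\<lambda>x\<in>G. \<xi> (\<phi> x))"

definition S_integer_map :: "nat set \<Rightarrow> (rat \<Rightarrow> complex) \<Rightarrow> (rat \<Rightarrow> complex)" where
  "S_integer_map S = dual_map (S_integers S) (\<lambda>r. 2 * r)"

(* Topological entropy following Adler, Konheim and McAndrew, for a continuous self-map T of a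
   compact space X. *)

definition is_open_cover :: "'a topology \<Rightarrow> 'a set set \<Rightarrow> bool" where
  "is_open_cover X \<U> \<longleftrightarrow> (\<forall>U\<in>\<U>. openin X U) \<and> \<Union>\<U> = topspace X"

definition min_subcover_card :: "'a topology \<Rightarrow> 'a set set \<Rightarrow> nat" where
  "min_subcover_card X \<U> = (LEAST m. \<exists>\<V>. \<V> \<subseteq> \<U> \<and> finite \<V> \<and> card \<V> = m \<and> \<Union>\<V> = topspace X)"

(* The join of the preimages of the cover under T^0, ..., T^(n-1). *)
definition iterated_join :: "'a topology \<Rightarrow> ('a \<Rightarrow> 'a) \<Rightarrow> 'a set set \<Rightarrow> nat \<Rightarrow> 'a set set" where
  "iterated_join X T \<U> n =
     {{x \<in> topspace X. \<forall>i<n. (T ^^ i) x \<in> U i} | U. \<forall>i<n. U i \<in> \<U>}"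

(* The limit exists by subadditivity, so it agrees with the limsup. *)
definition cover_entropy :: "'a topology \<Rightarrow> ('a \<Rightarrow> 'a) \<Rightarrow> 'a set set \<Rightarrow> ereal" where
  "cover_entropy X T \<U> =
     limsup (\<lambda>n. ereal (ln (real (min_subcover_card X (iterated_join X T \<U> n))) / real n))"

definition topological_entropy :: "'a topology \<Rightarrow> ('a \<Rightarrow> 'a) \<Rightarrow> ereal" where
  "topological_entropy X T = (SUP \<U>\<in>{\<U>. is_open_cover X \<U>}. cover_entropy X T \<U>)"

(* The cardinality condition makes n the least period, and it excludes n = 0. *)
definition closed_orbit :: "'a set \<Rightarrow> ('a \<Rightarrow> 'a) \<Rightarrow> nat \<Rightarrow> 'a set \<Rightarrow> bool" where
  "closed_orbit X T n \<tau> \<longleftrightarrow>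
     (\<exists>x\<in>X. (T ^^ n) x = x \<and> \<tau> = (\<lambda>i. (T ^^ i) x) ` {0..n} \<and> card \<tau> = n)"

(* The index set is finite for the maps S_integer_map S, and their entropy is finite, so neither
   the sum over an infinite set nor real_of_ereal takes its default value. *)
definition mertens_sum :: "nat set \<Rightarrow> nat \<Rightarrow> real" where
  "mertens_sum S N =
     (let X = dual_space (S_integers S); T = S_integer_map S;
          h = real_of_ereal (topological_entropy X T)
      in \<Sum>\<tau> | \<exists>n\<le>N. closed_orbit (topspace X) T n \<tau>. exp (- h * real (card \<tau>)))"

end

theory Submission
  imports Defs "HOL-Number_Theory.Number_Theory"
begin

text \<open>
  The entropy is \<open>ln 2\<close> because every open cover is refined by arcs in a single coordinate
  \<open>\<xi>(1/s)\<close>, on which the map acts by squaring. Characters fixed by the \<open>n\<close>-th iterate correspond to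
  \<open>m\<close>-th roots of unity, where \<open>m\<close> is the part of \<open>2^n - 1\<close> prime to \<open>S\<close>; points of smaller period
  are negligible, so \<open>M_S(N)\<close> is \<open>\<Sum>n\<le>N. \<bar>2^n - 1\<bar>\<^sub>S / n\<close> up to \<open>o(log N)\<close>, and it suffices to make the Cesaro
  mean of \<open>\<bar>2^n - 1\<bar>\<^sub>S\<close> equal to \<open>k\<close>.

  For each prime \<open>q\<close> fix a prime factor \<open>p(q)\<close> of \<open>2^q - 1\<close>, so that \<open>p(q)\<close> divides \<open>2^n - 1\<close> iff \<open>q\<close> divides \<open>n\<close>.
  For finite sets \<open>A\<close> of primes and \<open>S = p(A)\<close> the mean exists, since \<open>\<bar>2^n - 1\<bar>\<^sub>S\<close> is a uniform limit of
  periodic functions of \<open>n\<close>, and adding \<open>q\<close> to \<open>A\<close> lowers it by at most \<open>1/q\<close>. Run through the primes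
  and add \<open>q\<close> whenever the mean stays above \<open>k\<close>. The mean is at most
  \<open>1/Q + \<Prod>(1 - 1/q)\<close> over \<open>q \<ge> Q\<close> in \<open>A\<close>, so \<open>\<Sum>1/q\<close> converges over the resulting set; hence infinitely many
  primes were refused, each refusal at \<open>q\<close> shows that the mean was at most \<open>k + 1/q\<close>, and the limit is \<open>k\<close>.
\<close>

section \<open>Characters of the ring of S-integers\<close>

text \<open>These are the positive integers that become invertible in \<open>S_integers S\<close>,
  so exactly the denominators that an S-integer may carry.\<close>

definition S_number :: "nat set \<Rightarrow> nat \<Rightarrow> bool" where
  "S_number S b \<longleftrightarrow> b > 0 \<and> (\<forall>p. prime p \<and> p dvd b \<longrightarrow> p \<in> S)"

lemma S_number_1 [simp]: "S_number S 1" "S_number S (Suc 0)"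
  by (auto simp: S_number_def)

lemma S_number_pos: "S_number S b \<Longrightarrow> b > 0"
  by (simp add: S_number_def)

lemma S_number_mult: "S_number S b \<Longrightarrow> S_number S c \<Longrightarrow> S_number S (b * c)"
  by (auto simp: S_number_def prime_dvd_mult_iff)

text \<open>In lowest terms \<open>|r|_p\<close> exceeds 1 exactly when p divides the denominator.
  After this lemma S-integers are treated as fractions and p-adic absolute values no longer
  occur.\<close>

lemma S_integers_iff:
  "r \<in> S_integers S \<longleftrightarrow> (\<exists>a b. S_number S b \<and> r = of_int a / of_nat b)"
proof -
  obtain a b where ab: "quotient_of r = (a, b)" by (cases "quotient_of r")
  have b: "b > 0" and cop: "coprime a b" and r: "r = of_int a / of_int b"
    using ab quotient_of_denom_pos quotient_of_coprime quotient_of_div by blast+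
  show ?thesis
  proof
    assume R: "r \<in> S_integers S"
    have "p \<in> S" if p: "prime p" "p dvd nat b" for p
    proof (rule ccontr)
      assume "p \<notin> S"
      with R p have le: "padic_abs p r \<le> 1" by (auto simp: S_integers_def)
      have pb: "int p dvd b" using p(2) b by (metis int_dvd_int_iff int_nat_eq order_less_imp_le)
      have p1: "real p > 1" using p(1) prime_gt_1_nat by simp
      \<comment> \<open>Zero has its own clause in \<open>padic_abs\<close>; its reduced denominator
        is 1, which no prime divides.\<close>
      have "r \<noteq> 0"
      proof
        assume "r = 0"
        with ab have "b = 1" by simp
        with pb p(1) show False by simp
      qed
      have "\<not> int p dvd a" using cop pb p(1)
        by (metis coprime_common_divisor not_prime_unit prime_nat_int_transfer)
      then have "multiplicity (int p) a = 0" by (rule not_dvd_imp_multiplicity_0)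
      moreover have "multiplicity (int p) b > 0"
        using pb b p(1) by (subst prime_multiplicity_gt_zero_iff) auto
      ultimately have "padic_abs p r = real p ^ multiplicity (int p) b"
        using \<open>r \<noteq> 0\<close> by (simp add: padic_abs_def ab power_int_def)
      also have "\<dots> > 1" using p1 \<open>multiplicity (int p) b > 0\<close> by (intro one_less_power) auto
      finally show False using le by simp
    qed
    then have "S_number S (nat b)" using b by (auto simp: S_number_def)
    moreover have "r = of_int a / of_nat (nat b)" using r b by simp
    ultimately show "\<exists>a b. S_number S b \<and> r = of_int a / of_nat b" by blast
  next
    assume "\<exists>a b. S_number S b \<and> r = of_int a / of_nat b"
    then obtain c d where d: "S_number S d" and rc: "r = of_int c / of_nat d" by blast
    have d0: "d > 0" using d by (rule S_number_pos)
    \<comment> \<open>The given fraction need not be reduced, but cross-multiplying shows that the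
      reduced denominator divides \<open>d\<close>, so its prime factors lie in S as well.\<close>
    have "(of_int a * of_nat d :: rat) = of_int c * of_int b"
      using r rc b d0 by (simp add: field_simps)
    then have "(of_int (a * int d) :: rat) = of_int (c * b)" by simp
    then have "a * int d = c * b" by (simp only: of_int_eq_iff)
    then have "b dvd a * int d" by simp
    then have bd: "b dvd int d" using cop by (simp add: coprime_commute coprime_dvd_mult_right_iff)
    show "r \<in> S_integers S"
      unfolding S_integers_def
    proof (clarify)
      fix p assume p: "prime p" "p \<notin> S"
      have "\<not> p dvd d" using p d by (auto simp: S_number_def)
      then have "\<not> int p dvd b" using bd by (meson dvd_trans int_dvd_int_iff)
      then have "multiplicity (int p) b = 0" by (rule not_dvd_imp_multiplicity_0)
      then have "r = 0 \<or> padic_abs p r = inverse (real p ^ multiplicity (int p) a)"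
        by (auto simp: padic_abs_def ab power_int_def power_inverse)
      moreover have "real p ^ multiplicity (int p) a \<ge> 1"
        using p(1) prime_ge_1_nat by (intro one_le_power) simp
      ultimately show "padic_abs p r \<le> 1"
        by (auto simp: padic_abs_def inverse_le_1_iff)
    qed
  qed
qed

lemma S_integersE:
  assumes "r \<in> S_integers S"
  obtains a b where "S_number S b" "r = of_int a / of_nat b"
  using assms S_integers_iff by auto

lemma S_integers_of_int_div: "S_number S b \<Longrightarrow> of_int a / of_nat b \<in> S_integers S"
  using S_integers_iff by blast

lemma S_integers_inverse: "S_number S b \<Longrightarrow> 1 / of_nat b \<in> S_integers S"
  using S_integers_of_int_div[of S b 1] by simp

lemma S_integers_of_int [simp]: "of_int a \<in> S_integers S"
  using S_integers_of_int_div[of S 1 a] by simp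

lemma S_integers_of_nat [simp]: "of_nat a \<in> S_integers S"
  using S_integers_of_int[of "int a" S] by simp

lemma S_integers_0 [simp]: "0 \<in> S_integers S" and S_integers_1 [simp]: "1 \<in> S_integers S"
  using S_integers_of_int[of 0 S] S_integers_of_int[of 1 S] by simp_all

lemma S_integers_add:
  assumes "r \<in> S_integers S" "s \<in> S_integers S" shows "r + s \<in> S_integers S"
proof -
  obtain a b c d where "S_number S b" "r = of_int a / of_nat b" "S_number S d" "s = of_int c / of_nat d"
    using assms by (elim S_integersE)
  moreover from this have "r + s = of_int (a * int d + c * int b) / of_nat (b * d)"
    by (auto simp: S_number_def field_simps)
  ultimately show ?thesis by (metis S_integers_of_int_div S_number_mult)
qed

lemma S_integers_mult:
  assumes "r \<in> S_integers S" "s \<in> S_integers S" shows "r * s \<in> S_integers S"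
proof -
  obtain a b c d where "S_number S b" "r = of_int a / of_nat b" "S_number S d" "s = of_int c / of_nat d"
    using assms by (elim S_integersE)
  moreover from this have "r * s = of_int (a * c) / of_nat (b * d)"
    by auto
  ultimately show ?thesis by (metis S_integers_of_int_div S_number_mult)
qed

lemma S_integers_uminus: "r \<in> S_integers S \<Longrightarrow> - r \<in> S_integers S"
  using S_integers_mult[of "of_int (-1)" S r] S_integers_of_int[of "-1" S] by simp

lemma S_integers_diff: "r \<in> S_integers S \<Longrightarrow> s \<in> S_integers S \<Longrightarrow> r - s \<in> S_integers S"
  using S_integers_add[of r S "- s"] S_integers_uminus by simp

lemma S_integers_numeral_mult: "r \<in> S_integers S \<Longrightarrow> 2 * r \<in> S_integers S"
  using S_integers_mult[of "of_nat 2" S r] S_integers_of_nat[of 2 S] by simp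

lemma S_integers_power_mult: "r \<in> S_integers S \<Longrightarrow> 2 ^ i * r \<in> S_integers S"
  using S_integers_mult[of "of_nat (2 ^ i)" S r] S_integers_of_nat[of "2 ^ i" S] by simp

section \<open>The dual group and the iterates of its endomorphism\<close>

abbreviation S_dual :: "nat set \<Rightarrow> (rat \<Rightarrow> complex) set" where
  "S_dual S \<equiv> unitary_characters (S_integers S)"

lemma topspace_dual_space [simp]: "topspace (dual_space G) = unitary_characters G"
  by (auto simp: dual_space_def unitary_characters_def PiE_def)

lemma character_norm: "\<xi> \<in> unitary_characters G \<Longrightarrow> x \<in> G \<Longrightarrow> norm (\<xi> x) = 1"
  and character_add: "\<xi> \<in> unitary_characters G \<Longrightarrow> x \<in> G \<Longrightarrow> y \<in> G \<Longrightarrow> \<xi> (x + y) = \<xi> x * \<xi> y"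
  and character_extensional: "\<xi> \<in> unitary_characters G \<Longrightarrow> \<xi> \<in> extensional G"
  by (auto simp: unitary_characters_def)

lemma character_0:
  assumes "\<xi> \<in> S_dual S" shows "\<xi> 0 = 1"
proof -
  have "\<xi> 0 = \<xi> 0 * \<xi> 0" using character_add[OF assms, of 0 0] by simp
  moreover have "\<xi> 0 \<noteq> 0" using character_norm[OF assms, of 0] by auto
  ultimately show ?thesis by simp
qed

lemma character_of_nat_mult:
  assumes "\<xi> \<in> S_dual S" "x \<in> S_integers S" shows "\<xi> (of_nat n * x) = \<xi> x ^ n"
proof (induction n)
  case 0 show ?case using character_0[OF assms(1)] by simp
next
  case (Suc n)
  have "\<xi> (of_nat (Suc n) * x) = \<xi> (x + of_nat n * x)" by (simp add: algebra_simps)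
  also have "\<dots> = \<xi> x * \<xi> (of_nat n * x)"
    using assms by (intro character_add) (auto intro: S_integers_mult)
  finally show ?case using Suc by simp
qed

lemma character_uminus:
  assumes "\<xi> \<in> S_dual S" "x \<in> S_integers S" shows "\<xi> (- x) = cnj (\<xi> x)"
proof -
  have "\<xi> x * \<xi> (- x) = 1"
    using character_add[OF assms(1) assms(2) S_integers_uminus[OF assms(2)]] character_0[OF assms(1)]
    by simp
  moreover have "\<xi> x * cnj (\<xi> x) = 1"
    using character_norm[OF assms] by (simp add: complex_norm_square[symmetric])
  moreover have "\<xi> x \<noteq> 0" using character_norm[OF assms] by auto
  ultimately show ?thesis by (metis mult_cancel_left)
qed

text \<open>On the unit circle the n-th power map is n-Lipschitz, and a character sends n * x to the
  n-th power of its value at x. Negative multiples follow by complex conjugation, an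
  isometry.\<close>

lemma dist_character_of_int_mult:
  assumes "\<xi> \<in> S_dual S" "\<eta> \<in> S_dual S" "x \<in> S_integers S"
  shows "dist (\<xi> (of_int c * x)) (\<eta> (of_int c * x)) \<le> of_int \<bar>c\<bar> * dist (\<xi> x) (\<eta> x)"
proof -
  have nat: "dist (\<xi> (of_nat n * x)) (\<eta> (of_nat n * x)) \<le> of_nat n * dist (\<xi> x) (\<eta> x)" for n
    using norm_power_diff[of "\<xi> x" "\<eta> x" n] assms
    by (simp add: character_of_nat_mult character_norm dist_norm)
  show ?thesis
  proof (cases "c \<ge> 0")
    case True
    then show ?thesis using nat[of "nat c"] by simp
  next
    case False
    then have c: "c = - int (nat (- c))" by simp
    have x: "of_nat (nat (- c)) * x \<in> S_integers S"
      using assms by (auto intro: S_integers_mult)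
    have "dist (\<xi> (- (of_nat (nat (- c)) * x))) (\<eta> (- (of_nat (nat (- c)) * x)))
        = dist (\<xi> (of_nat (nat (- c)) * x)) (\<eta> (of_nat (nat (- c)) * x))"
      unfolding character_uminus[OF assms(1) x] character_uminus[OF assms(2) x] dist_norm
      by (metis complex_cnj_diff complex_mod_cnj)
    then show ?thesis using nat[of "nat (- c)"] False by simp
  qed
qed

lemma S_integer_map_funpow:
  assumes "\<xi> \<in> S_dual S"
  shows "(S_integer_map S ^^ i) \<xi> = (\<lambda>x\<in>S_integers S. \<xi> (2 ^ i * x))"
proof (induction i)
  case 0
  show ?case using character_extensional[OF assms] by (simp add: extensional_restrict)
next
  case (Suc i)
  show ?case
    unfolding funpow.simps comp_def Suc
    using S_integers_numeral_mult
    by (auto simp: S_integer_map_def dual_map_def fun_eq_iff mult_ac restrict_def)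
qed

lemma S_integer_map_in_S_dual:
  assumes "\<xi> \<in> S_dual S" shows "S_integer_map S \<xi> \<in> S_dual S"
proof -
  have "S_integer_map S \<xi> (x + y) = S_integer_map S \<xi> x * S_integer_map S \<xi> y"
    if "x \<in> S_integers S" "y \<in> S_integers S" for x y
    using that character_add[OF assms S_integers_numeral_mult S_integers_numeral_mult, of x y]
    by (simp add: S_integer_map_def dual_map_def S_integers_add distrib_left)
  then show ?thesis
    using assms by (auto simp: unitary_characters_def S_integer_map_def dual_map_def S_integers_numeral_mult)
qed

lemma S_integer_map_funpow_in_S_dual:
  "\<xi> \<in> S_dual S \<Longrightarrow> (S_integer_map S ^^ i) \<xi> \<in> S_dual S"
  by (induction i) (auto intro: S_integer_map_in_S_dual)

lemma S_integer_map_funpow_apply: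
  assumes "\<xi> \<in> S_dual S" "x \<in> S_integers S"
  shows "(S_integer_map S ^^ i) \<xi> x = \<xi> x ^ (2 ^ i)"
  using assms character_of_nat_mult[OF assms, of "2 ^ i"] by (simp add: S_integer_map_funpow)

section \<open>Compactness of the dual, and its topology read off from single coordinates\<close>

lemma continuous_map_eval:
  assumes "x \<in> G" shows "continuous_map (dual_space G) euclidean (\<lambda>\<xi>. \<xi> x)"
  unfolding dual_space_def
  using assms by (intro continuous_map_from_subtopology continuous_map_product_projection)

text \<open>By Tychonoff a product of circles is compact, and the dual is cut out of it by the
  closed conditions \<open>\<xi> (x + y) = \<xi> x * \<xi> y\<close>.\<close>

lemma compact_space_dual_space: "compact_space (dual_space (S_integers S))"
proof -
  let ?P = "product_topology (\<lambda>_::rat. euclidean :: complex topology) (S_integers S)"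
  let ?R = "S_integers S"
  let ?K = "PiE ?R (\<lambda>_. sphere (0::complex) 1)"
  let ?E = "\<lambda>x y. {\<xi> \<in> topspace ?P. \<xi> (x + y) - \<xi> x * \<xi> y \<in> {0}}"
  have K: "compactin ?P ?K" by (simp add: compactin_PiE)
  have E: "closedin ?P (?E x y)" if "x \<in> ?R" "y \<in> ?R" for x y
  proof (rule closedin_continuous_map_preimage)
    have c: "continuous_map ?P euclidean (\<lambda>\<xi>. \<xi> z)" if "z \<in> ?R" for z
      using that by (rule continuous_map_product_projection)
    have "continuous_map ?P (prod_topology euclidean euclidean) (\<lambda>\<xi>. (\<xi> x, \<xi> y))"
      using that c[of x] c[of y] by (intro continuous_map_pairedI) auto
    then have "continuous_map ?P euclidean ((\<lambda>(a, b). a * b) \<circ> (\<lambda>\<xi>. (\<xi> x, \<xi> y)))"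
      by (rule continuous_map_compose)
        (auto simp: euclidean_product_topology case_prod_unfold intro!: continuous_intros)
    then have m: "continuous_map ?P euclidean (\<lambda>\<xi>. \<xi> x * \<xi> y)" by (simp add: o_def)
    show "continuous_map ?P euclidean (\<lambda>\<xi>. \<xi> (x + y) - \<xi> x * \<xi> y)"
      using c[OF S_integers_add[OF that]] m by (rule continuous_map_diff)
    show "closedin euclidean {0::complex}" by simp
  qed
  have eq: "S_dual S = ?K \<inter> \<Inter> ((\<lambda>(x, y). ?E x y) ` (?R \<times> ?R))"
    by (auto simp: unitary_characters_def PiE_def Pi_def S_integers_add)
  have ne: "?R \<noteq> {}" using S_integers_0 by blast
  have "compactin ?P (S_dual S)" unfolding eq
    using E ne by (intro compact_Int_closedin K closedin_Inter) auto
  then show ?thesis unfolding dual_space_def by (simp add: compact_space_subtopology)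
qed

text \<open>Finitely many S-integers have a common denominator s, so all are integer multiples of
  \<open>1 / s\<close>, and closeness at this one coordinate spreads to them by the Lipschitz bound.
  The induction multiplies denominators one at a time.\<close>

lemma uniform_denominator:
  assumes "finite F" "F \<subseteq> S_integers S" "\<epsilon> > 0"
  shows "\<exists>s \<delta>. S_number S s \<and> \<delta> > 0 \<and> (\<forall>\<xi>\<in>S_dual S. \<forall>\<eta>\<in>S_dual S.
           dist (\<xi> (1 / of_nat s)) (\<eta> (1 / of_nat s)) < \<delta> \<longrightarrow> (\<forall>x\<in>F. dist (\<xi> x) (\<eta> x) < \<epsilon>))"
  using assms(1,2)
proof (induction F rule: finite_induct)
  case empty
  show ?case by (intro exI[of _ 1]) auto
next
  case (insert r F)
  obtain s \<delta> where s: "S_number S s" "\<delta> > 0" and F: "\<And>\<xi> \<eta> x. \<xi> \<in> S_dual S \<Longrightarrow> \<eta> \<in> S_dual S \<Longrightarrow>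
           dist (\<xi> (1 / of_nat s)) (\<eta> (1 / of_nat s)) < \<delta> \<Longrightarrow> x \<in> F \<Longrightarrow> dist (\<xi> x) (\<eta> x) < \<epsilon>"
    using insert.IH insert.prems by auto
  obtain c d where d: "S_number S d" and r: "r = of_int c / of_nat d"
    using insert.prems by (meson S_integersE insert_subset)
  \<comment> \<open>The added 1 makes \<open>C\<close> positive even when c = 0, so that it can be
    divided by.\<close>
  define C where "C = real_of_int \<bar>c\<bar> * s + 1"
  have C: "C > 0" unfolding C_def by (simp add: add_nonneg_pos)
  have d0: "real d > 0" "real s > 0" using d s S_number_pos by simp_all
  \<comment> \<open>Passing from \<open>1 / (s * d)\<close> to \<open>1 / s\<close> stretches
    distances by at most d, passing to r by at most \<open>C\<close>; the two quotients compensate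
    for this.\<close>
  define e where "e = min (\<delta> / d) (\<epsilon> / C)"
  have sd: "S_number S (s * d)" using s d by (simp add: S_number_mult)
  have "e > 0" using d0 C s assms by (simp add: e_def)
  moreover have "dist (\<xi> x) (\<eta> x) < \<epsilon>"
    if \<xi>: "\<xi> \<in> S_dual S" and \<eta>: "\<eta> \<in> S_dual S" and x: "x \<in> insert r F"
      and lt: "dist (\<xi> (1 / of_nat (s * d))) (\<eta> (1 / of_nat (s * d))) < e" for \<xi> \<eta> x
  proof -
    let ?y = "1 / of_nat (s * d) :: rat"
    have y: "?y \<in> S_integers S" using sd by (rule S_integers_inverse)
    have y1: "1 / of_nat s = of_int (int d) * ?y" and yr: "r = of_int (c * int s) * ?y"
      using d0 r by simp_all
    have "dist (\<xi> (1 / of_nat s)) (\<eta> (1 / of_nat s)) \<le> d * dist (\<xi> ?y) (\<eta> ?y)"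
      using dist_character_of_int_mult[OF \<xi> \<eta> y, of "int d"] unfolding y1 by simp
    also have "\<dots> < d * (\<delta> / d)" using lt d0 by (intro mult_strict_left_mono) (auto simp: e_def)
    finally have 1: "dist (\<xi> (1 / of_nat s)) (\<eta> (1 / of_nat s)) < \<delta>" using d0 by simp
    have "dist (\<xi> r) (\<eta> r) \<le> (C - 1) * dist (\<xi> ?y) (\<eta> ?y)"
      using dist_character_of_int_mult[OF \<xi> \<eta> y, of "c * int s"] unfolding yr
      by (simp add: C_def abs_mult)
    also have "\<dots> \<le> C * dist (\<xi> ?y) (\<eta> ?y)" by (intro mult_right_mono) auto
    also have "\<dots> < C * (\<epsilon> / C)" using lt C by (intro mult_strict_left_mono) (auto simp: e_def)
    finally have "dist (\<xi> r) (\<eta> r) < \<epsilon>" using C by simp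
    with F[OF \<xi> \<eta> 1] x show ?thesis by auto
  qed
  ultimately show ?case using sd by blast
qed

text \<open>A basic open set of the product topology restricts only finitely many coordinates, and
  these are controlled by one coordinate with a common denominator.\<close>

lemma S_dual_nbhd:
  assumes U: "openin (dual_space (S_integers S)) U" and \<xi>: "\<xi> \<in> U"
  shows "\<exists>s \<delta>. S_number S s \<and> \<delta> > 0 \<and>
           (\<forall>\<eta>\<in>S_dual S. dist (\<eta> (1 / of_nat s)) (\<xi> (1 / of_nat s)) < \<delta> \<longrightarrow> \<eta> \<in> U)"
proof -
  have \<xi>X: "\<xi> \<in> S_dual S" using openin_subset[OF U] \<xi> by auto
  obtain V where V: "openin (product_topology (\<lambda>_::rat. euclidean :: complex topology) (S_integers S)) V"
    and UV: "U = V \<inter> S_dual S"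
    using U by (auto simp: dual_space_def openin_subtopology)
  have "\<exists>W. finite {i \<in> S_integers S. W i \<noteq> UNIV} \<and> (\<forall>i\<in>S_integers S. open (W i)) \<and>
          \<xi> \<in> PiE (S_integers S) W \<and> PiE (S_integers S) W \<subseteq> V"
    using V \<xi> UV unfolding openin_product_topology_alt by simp
  then obtain W where W: "finite {i \<in> S_integers S. W i \<noteq> UNIV}"
      "\<And>i. i \<in> S_integers S \<Longrightarrow> open (W i)" "\<xi> \<in> PiE (S_integers S) W" "PiE (S_integers S) W \<subseteq> V"
    by blast
  define F where "F = {i \<in> S_integers S. W i \<noteq> UNIV}"
  have "\<exists>e>0. \<forall>i\<in>F. ball (\<xi> i) e \<subseteq> W i"
  proof -
    have "\<exists>e. e > 0 \<and> ball (\<xi> i) e \<subseteq> W i" if "i \<in> F" for i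
    proof -
      have "open (W i)" "\<xi> i \<in> W i" using that W(2) PiE_mem[OF W(3)] by (auto simp: F_def)
      then show ?thesis by (meson open_contains_ball)
    qed
    then obtain e where e: "\<And>i. i \<in> F \<Longrightarrow> e i > 0 \<and> ball (\<xi> i) (e i) \<subseteq> W i" by metis
    have "finite F" using W(1) by (simp add: F_def)
    define e0 where "e0 = Min (insert 1 (e ` F))"
    have "e0 > 0" using e \<open>finite F\<close> by (auto simp: e0_def)
    moreover have "e0 \<le> e i" if "i \<in> F" for i using that \<open>finite F\<close> by (auto simp: e0_def)
    then have "ball (\<xi> i) e0 \<subseteq> W i" if "i \<in> F" for i
      using that e by (meson subset_ball subset_trans)
    ultimately show ?thesis by blast
  qed
  then obtain e where e: "e > 0" "\<And>i. i \<in> F \<Longrightarrow> ball (\<xi> i) e \<subseteq> W i" by blast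
  obtain s \<delta> where s: "S_number S s" "\<delta> > 0" "\<forall>\<xi>\<in>S_dual S. \<forall>\<eta>\<in>S_dual S.
           dist (\<xi> (1 / of_nat s)) (\<eta> (1 / of_nat s)) < \<delta> \<longrightarrow> (\<forall>x\<in>F. dist (\<xi> x) (\<eta> x) < e)"
    using uniform_denominator[of F S e] W(1) e(1) by (auto simp: F_def)
  have "\<eta> \<in> U" if \<eta>: "\<eta> \<in> S_dual S" "dist (\<eta> (1 / of_nat s)) (\<xi> (1 / of_nat s)) < \<delta>" for \<eta>
  proof -
    have "\<eta> i \<in> W i" if "i \<in> S_integers S" for i
    proof (cases "i \<in> F")
      case True
      then have "dist (\<eta> i) (\<xi> i) < e" using s \<eta> \<xi>X by blast
      then show ?thesis using e(2)[OF True] by (auto simp: dist_commute)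
    qed (use that in \<open>auto simp: F_def\<close>)
    then have "\<eta> \<in> PiE (S_integers S) W"
      using character_extensional[OF \<eta>(1)] by (auto simp: PiE_def)
    then show ?thesis using W(4) UV \<eta>(1) by auto
  qed
  with s show ?thesis by blast
qed

text \<open>The Lebesgue number argument: finitely many sets \<open>B \<xi>\<close> of half the
  admissible radius cover the dual, one coordinate \<open>1 / t\<close> controls all the coordinates
  in which they are described, and the other half of the radius is spent in the triangle
  inequality.\<close>

lemma S_dual_Lebesgue_number:
  assumes "is_open_cover (dual_space (S_integers S)) \<U>"
  shows "\<exists>s \<delta>. S_number S s \<and> \<delta> > 0 \<and> (\<forall>\<xi>\<in>S_dual S. \<exists>U\<in>\<U>.
           \<forall>\<eta>\<in>S_dual S. dist (\<eta> (1 / of_nat s)) (\<xi> (1 / of_nat s)) < \<delta> \<longrightarrow> \<eta> \<in> U)"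
proof -
  let ?X = "dual_space (S_integers S)"
  have op: "\<And>U. U \<in> \<U> \<Longrightarrow> openin ?X U" and cov: "\<Union>\<U> = S_dual S"
    using assms by (auto simp: is_open_cover_def)
  have "\<forall>\<xi>\<in>S_dual S. \<exists>U s \<delta>. U \<in> \<U> \<and> S_number S s \<and> \<delta> > 0 \<and>
           (\<forall>\<eta>\<in>S_dual S. dist (\<eta> (1 / of_nat s)) (\<xi> (1 / of_nat s)) < \<delta> \<longrightarrow> \<eta> \<in> U)"
    using cov op S_dual_nbhd by (metis UnionE)
  then obtain U s \<delta> where U: "\<And>\<xi>. \<xi> \<in> S_dual S \<Longrightarrow> U \<xi> \<in> \<U>"
    and s: "\<And>\<xi>. \<xi> \<in> S_dual S \<Longrightarrow> S_number S (s \<xi>)"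
    and \<delta>: "\<And>\<xi>. \<xi> \<in> S_dual S \<Longrightarrow> \<delta> \<xi> > (0::real)"
    and near: "\<And>\<xi> \<eta>. \<xi> \<in> S_dual S \<Longrightarrow> \<eta> \<in> S_dual S \<Longrightarrow>
        dist (\<eta> (1 / of_nat (s \<xi>))) (\<xi> (1 / of_nat (s \<xi>))) < \<delta> \<xi> \<Longrightarrow> \<eta> \<in> U \<xi>"
    by metis
  define B where "B = (\<lambda>\<xi>. {\<eta> \<in> topspace ?X. \<eta> (1 / of_nat (s \<xi>)) \<in> ball (\<xi> (1 / of_nat (s \<xi>))) (\<delta> \<xi> / 2)})"
  have Bop: "openin ?X (B \<xi>)" if "\<xi> \<in> S_dual S" for \<xi>
    unfolding B_def using s[OF that]
    by (intro openin_continuous_map_preimage[where Y = euclidean] continuous_map_eval S_integers_inverse) auto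
  have "\<exists>\<F>. finite \<F> \<and> \<F> \<subseteq> B ` S_dual S \<and> topspace ?X \<subseteq> \<Union>\<F>"
    using compact_space_dual_space[of S] unfolding compact_space_def compactin_def
  proof (elim conjE allE impE)
    show "Ball (B ` S_dual S) (openin ?X) \<and> topspace ?X \<subseteq> \<Union> (B ` S_dual S)"
      using Bop \<delta> by (fastforce simp: B_def)
  qed auto
  then obtain I where I: "finite I" "I \<subseteq> S_dual S" "S_dual S \<subseteq> \<Union> (B ` I)"
    by (metis finite_subset_image topspace_dual_space)
  define e where "e = Min (insert 1 ((\<lambda>\<xi>. \<delta> \<xi> / 2) ` I))"
  have e: "e > 0" using I \<delta> by (auto simp: e_def)
  have e': "e \<le> \<delta> \<xi> / 2" if "\<xi> \<in> I" for \<xi>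
    unfolding e_def using that I by (intro Min_le) auto
  let ?F = "(\<lambda>\<xi>. 1 / of_nat (s \<xi>)) ` I :: rat set"
  have "finite ?F" "?F \<subseteq> S_integers S"
    using I s S_integers_inverse by auto
  from uniform_denominator[OF this e] obtain t d where t: "S_number S t" "d > 0"
      and tF: "\<And>\<xi> \<eta> x. \<xi> \<in> S_dual S \<Longrightarrow> \<eta> \<in> S_dual S \<Longrightarrow>
        dist (\<xi> (1 / of_nat t)) (\<eta> (1 / of_nat t)) < d \<Longrightarrow> x \<in> ?F \<Longrightarrow> dist (\<xi> x) (\<eta> x) < e"
    by meson
  have "\<exists>V\<in>\<U>. \<forall>\<eta>\<in>S_dual S. dist (\<eta> (1 / of_nat t)) (\<xi> (1 / of_nat t)) < d \<longrightarrow> \<eta> \<in> V"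
    if \<xi>: "\<xi> \<in> S_dual S" for \<xi>
  proof -
    obtain \<zeta> where \<zeta>: "\<zeta> \<in> I" "\<xi> \<in> B \<zeta>" using I \<xi> by auto
    then have \<zeta>X: "\<zeta> \<in> S_dual S" using I by auto
    show ?thesis
    proof (intro bexI[of _ "U \<zeta>"] ballI impI)
      fix \<eta> assume \<eta>: "\<eta> \<in> S_dual S" "dist (\<eta> (1 / of_nat t)) (\<xi> (1 / of_nat t)) < d"
      let ?x = "1 / of_nat (s \<zeta>) :: rat"
      have "dist (\<eta> ?x) (\<xi> ?x) < e" using \<zeta> by (intro tF \<eta> \<xi>) auto
      moreover have "dist (\<zeta> ?x) (\<xi> ?x) < \<delta> \<zeta> / 2" using \<zeta> by (simp add: B_def)
      ultimately have "dist (\<eta> ?x) (\<zeta> ?x) < \<delta> \<zeta>"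
        using e'[OF \<zeta>(1)] dist_triangle2[of "\<eta> ?x" "\<zeta> ?x" "\<xi> ?x"] by linarith
      then show "\<eta> \<in> U \<zeta>" using near \<zeta>X \<eta>(1) by blast
    qed (use U \<zeta>X in auto)
  qed
  with t show ?thesis by blast
qed

section \<open>Topological entropy\<close>

text \<open>A chord is at most as long as its arc. The jump of \<open>Arg2pi\<close> at 1 does no
  harm, since the bound holds for any pair of real arguments of the two points.\<close>

lemma dist_Arg2pi_le:
  assumes "norm z = 1" "norm w = 1"
  shows "dist z w \<le> \<bar>Arg2pi z - Arg2pi w\<bar>"
proof -
  have *: "z = cis (Arg2pi z)" if "norm z = 1" for z
    using Arg2pi_eq[of z] that by (simp add: cis_conv_exp)
  have "dist (cis a) (cis b) \<le> \<bar>a - b\<bar>" for a b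
  proof -
    have "cis a - cis b = cis b * (cis (a - b) - 1)" by (simp add: algebra_simps cis_mult)
    then have "norm (cis a - cis b) = norm (cis (a - b) - 1)" by (simp add: norm_mult)
    also have "\<dots> = 2 * \<bar>sin ((a - b) / 2)\<bar>"
      using dist_exp_i_1[of "a - b"] by (simp only: cis_conv_exp)
    also have "\<dots> \<le> \<bar>a - b\<bar>" using abs_sin_x_le_abs_x[of "(a - b) / 2"] by simp
    finally show ?thesis by (simp add: dist_norm)
  qed
  then show ?thesis using *[OF assms(1)] *[OF assms(2)] by metis
qed

lemma dist_power_le:
  fixes z w :: complex
  assumes "norm z = 1" "norm w = 1"
  shows "dist (z ^ n) (w ^ n) \<le> n * dist z w"
  using norm_power_diff[of z w n] assms by (simp add: dist_norm)

text \<open>Cut the circle into K * 2^n equal arcs. Squaring at most doubles distances, so two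
  characters whose values at \<open>1 / s\<close> share an arc stay within \<delta> of each other at
  that coordinate for n steps. Hence the cell of the join built around one character contains every
  character in the same arc.\<close>

lemma iterated_join_subcover:
  assumes "is_open_cover (dual_space (S_integers S)) \<U>"
  shows "\<exists>K>0. \<forall>n. \<exists>\<V>. \<V> \<subseteq> iterated_join (dual_space (S_integers S)) (S_integer_map S) \<U> n \<and> finite \<V> \<and>
           card \<V> \<le> K * 2 ^ n \<and> \<Union>\<V> = S_dual S"
proof -
  let ?X = "dual_space (S_integers S)" and ?T = "S_integer_map S"
  obtain s \<delta> where s: "S_number S s" and \<delta>: "\<delta> > 0" and L: "\<forall>\<xi>\<in>S_dual S. \<exists>U\<in>\<U>.
           \<forall>\<eta>\<in>S_dual S. dist (\<eta> (1 / of_nat s)) (\<xi> (1 / of_nat s)) < \<delta> \<longrightarrow> \<eta> \<in> U"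
    using S_dual_Lebesgue_number[OF assms] by blast
  from L obtain U where U: "\<And>\<xi>. \<xi> \<in> S_dual S \<Longrightarrow> U \<xi> \<in> \<U>"
      and near: "\<And>\<xi> \<eta>. \<xi> \<in> S_dual S \<Longrightarrow> \<eta> \<in> S_dual S \<Longrightarrow>
        dist (\<eta> (1 / of_nat s)) (\<xi> (1 / of_nat s)) < \<delta> \<Longrightarrow> \<eta> \<in> U \<xi>"
    by metis
  define x where "x = (1 / of_nat s :: rat)"
  have x: "x \<in> S_integers S" unfolding x_def using s by (rule S_integers_inverse)
  \<comment> \<open>An arc of length 2 pi / (K * 2^n) is stretched at most to 2 pi / K in n
    doublings, and this has to stay below \<delta>.\<close>
  obtain K :: nat where K: "K > 2 * pi / \<delta>" using reals_Archimedean2 by blast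
  have "2 * pi / \<delta> > 0" using \<delta> by simp
  then have K0: "K > 0" using K by (metis less_trans of_nat_0_less_iff)
  have "\<exists>\<V>. \<V> \<subseteq> iterated_join ?X ?T \<U> n \<and> finite \<V> \<and> card \<V> \<le> K * 2 ^ n \<and> \<Union>\<V> = S_dual S" for n
  proof -
    define M where "M = K * 2 ^ n"
    have M: "M > 0" using K0 by (simp add: M_def)
    define arc where "arc = (\<lambda>\<xi>::rat \<Rightarrow> complex. nat \<lfloor>Arg2pi (\<xi> x) * M / (2 * pi)\<rfloor>)"
    define E where "E = (\<lambda>\<xi>. {\<eta> \<in> S_dual S. \<forall>i<n. (?T ^^ i) \<eta> \<in> U ((?T ^^ i) \<xi>)})"
    have arc_less: "arc \<xi> < M" for \<xi>
    proof -
      have "Arg2pi (\<xi> x) * M / (2 * pi) < M" "Arg2pi (\<xi> x) * M / (2 * pi) \<ge> 0"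
        using Arg2pi[of "\<xi> x"] M by (simp_all add: field_simps)
      then show ?thesis unfolding arc_def by linarith
    qed
    have in_E: "\<eta> \<in> E \<xi>" if \<xi>: "\<xi> \<in> S_dual S" and \<eta>: "\<eta> \<in> S_dual S" and eq: "arc \<eta> = arc \<xi>" for \<xi> \<eta>
    proof -
      have "\<lfloor>Arg2pi (\<eta> x) * M / (2 * pi)\<rfloor> = \<lfloor>Arg2pi (\<xi> x) * M / (2 * pi)\<rfloor>"
        using eq Arg2pi[of "\<xi> x"] Arg2pi[of "\<eta> x"] unfolding arc_def
        by (subst (asm) eq_nat_nat_iff) auto
      then have "\<bar>Arg2pi (\<eta> x) * M / (2 * pi) - Arg2pi (\<xi> x) * M / (2 * pi)\<bar> < 1"
        by linarith
      moreover have "Arg2pi (\<eta> x) * M / (2 * pi) - Arg2pi (\<xi> x) * M / (2 * pi)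
          = (Arg2pi (\<eta> x) - Arg2pi (\<xi> x)) * (M / (2 * pi))"
        by (simp add: left_diff_distrib diff_divide_distrib)
      ultimately have "\<bar>Arg2pi (\<eta> x) - Arg2pi (\<xi> x)\<bar> * (M / (2 * pi)) < 1"
        by (simp add: abs_mult)
      then have "\<bar>Arg2pi (\<eta> x) - Arg2pi (\<xi> x)\<bar> < 1 / (M / (2 * pi))"
        using M by (subst pos_less_divide_eq) auto
      then have "\<bar>Arg2pi (\<eta> x) - Arg2pi (\<xi> x)\<bar> < 2 * pi / M" by simp
      then have d: "dist (\<eta> x) (\<xi> x) < 2 * pi / M"
        using dist_Arg2pi_le[of "\<eta> x" "\<xi> x"] character_norm x \<xi> \<eta> by fastforce
      have "(?T ^^ i) \<eta> \<in> U ((?T ^^ i) \<xi>)" if "i < n" for i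
      proof (rule near)
        have "dist ((?T ^^ i) \<eta> x) ((?T ^^ i) \<xi> x) \<le> (2 ^ i) * dist (\<eta> x) (\<xi> x)"
          using dist_power_le[of "\<eta> x" "\<xi> x" "2 ^ i"] character_norm[OF \<xi> x] character_norm[OF \<eta> x] x \<xi> \<eta>
          by (simp add: S_integer_map_funpow_apply)
        also have "\<dots> \<le> 2 ^ n * dist (\<eta> x) (\<xi> x)"
          using that by (intro mult_right_mono power_increasing) auto
        also have "\<dots> < 2 ^ n * (2 * pi / M)" using d by (intro mult_strict_left_mono) auto
        also have "\<dots> = 2 * pi / K" by (simp add: M_def)
        also have "\<dots> < \<delta>" using K \<delta> K0 by (simp add: field_simps)
        finally show "dist ((?T ^^ i) \<eta> (1 / of_nat s)) ((?T ^^ i) \<xi> (1 / of_nat s)) < \<delta>"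
          by (simp add: x_def)
      qed (use \<xi> \<eta> S_integer_map_funpow_in_S_dual in auto)
      then show ?thesis using \<eta> by (simp add: E_def)
    qed
    \<comment> \<open>Only arcs that contain the value of some character index the subcover, so the
      choice is always between existing characters.\<close>
    define rep where "rep = (\<lambda>j. SOME \<xi>. \<xi> \<in> S_dual S \<and> arc \<xi> = j)"
    have rep: "rep (arc \<xi>) \<in> S_dual S" "arc (rep (arc \<xi>)) = arc \<xi>" if "\<xi> \<in> S_dual S" for \<xi>
      using someI[of "\<lambda>\<eta>. \<eta> \<in> S_dual S \<and> arc \<eta> = arc \<xi>" \<xi>] that by (auto simp: rep_def)
    let ?V = "(\<lambda>j. E (rep j)) ` arc ` S_dual S"
    have arcs: "arc ` S_dual S \<subseteq> {..<M}" using arc_less by auto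
    show ?thesis
    proof (intro exI[of _ ?V] conjI)
      have "E \<xi> \<in> iterated_join ?X ?T \<U> n" if "\<xi> \<in> S_dual S" for \<xi>
        unfolding iterated_join_def E_def topspace_dual_space
        using U[OF S_integer_map_funpow_in_S_dual[OF that]]
        by (intro CollectI exI[of _ "\<lambda>i. U ((?T ^^ i) \<xi>)"]) auto
      then show "?V \<subseteq> iterated_join ?X ?T \<U> n" using rep(1) by blast
      show "finite ?V" using arcs finite_subset by blast
      have "card ?V \<le> card (arc ` S_dual S)"
        using arcs by (intro card_image_le) (auto intro: finite_subset)
      also have "\<dots> \<le> card {..<M}" using arcs by (intro card_mono) auto
      finally show "card ?V \<le> K * 2 ^ n" by (simp add: M_def)
      show "\<Union>?V = S_dual S"
      proof
        show "\<Union>?V \<subseteq> S_dual S" by (auto simp: E_def)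
        show "S_dual S \<subseteq> \<Union>?V"
        proof
          fix \<eta> assume \<eta>: "\<eta> \<in> S_dual S"
          then have "\<eta> \<in> E (rep (arc \<eta>))" using rep in_E by metis
          with \<eta> show "\<eta> \<in> \<Union>?V" by blast
        qed
      qed
    qed
  qed
  with K0 show ?thesis by blast
qed

text \<open>The preceding lemma supplies a finite subcover, so the \<open>LEAST\<close> in
  \<open>min_subcover_card\<close> ranges over a nonempty set and is attained.\<close>

lemma min_subcover_card_attained:
  assumes "is_open_cover (dual_space (S_integers S)) \<U>"
  shows "\<exists>\<V>. \<V> \<subseteq> iterated_join (dual_space (S_integers S)) (S_integer_map S) \<U> n \<and> finite \<V> \<and>
           card \<V> = min_subcover_card (dual_space (S_integers S))
             (iterated_join (dual_space (S_integers S)) (S_integer_map S) \<U> n) \<and> \<Union>\<V> = S_dual S"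
proof -
  let ?P = "\<lambda>m. \<exists>\<V>. \<V> \<subseteq> iterated_join (dual_space (S_integers S)) (S_integer_map S) \<U> n \<and> finite \<V> \<and>
           card \<V> = m \<and> \<Union>\<V> = topspace (dual_space (S_integers S))"
  obtain K where "\<forall>n. \<exists>\<V>. \<V> \<subseteq> iterated_join (dual_space (S_integers S)) (S_integer_map S) \<U> n \<and>
        finite \<V> \<and> card \<V> \<le> K * 2 ^ n \<and> \<Union>\<V> = S_dual S"
    using iterated_join_subcover[OF assms] by (elim exE conjE) (rule that)
  from spec[OF this, of n] have "\<exists>m. ?P m" by auto
  then have "?P (LEAST m. ?P m)" by (rule LeastI_ex)
  then show ?thesis by (simp add: min_subcover_card_def)
qed

lemma cover_entropy_le:
  assumes "is_open_cover (dual_space (S_integers S)) \<U>"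
  shows "cover_entropy (dual_space (S_integers S)) (S_integer_map S) \<U> \<le> ereal (ln 2)"
proof -
  let ?N = "\<lambda>n. min_subcover_card (dual_space (S_integers S))
             (iterated_join (dual_space (S_integers S)) (S_integer_map S) \<U> n)"
  obtain K where K: "K > 0" and V: "\<And>n. \<exists>\<V>. \<V> \<subseteq> iterated_join (dual_space (S_integers S)) (S_integer_map S) \<U> n \<and>
        finite \<V> \<and> card \<V> \<le> K * 2 ^ n \<and> \<Union>\<V> = S_dual S"
    using iterated_join_subcover[OF assms] by (elim exE conjE) (rule that, assumption, erule spec)
  have N: "?N n \<le> K * 2 ^ n" for n
  proof -
    obtain \<V> where "\<V> \<subseteq> iterated_join (dual_space (S_integers S)) (S_integer_map S) \<U> n"
        "finite \<V>" "card \<V> \<le> K * 2 ^ n" "\<Union>\<V> = S_dual S"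
      using V[of n] by (elim exE conjE) (rule that)
    then have "?N n \<le> card \<V>" unfolding min_subcover_card_def
      by (intro Least_le exI[of _ \<V>]) simp
    with \<open>card \<V> \<le> K * 2 ^ n\<close> show ?thesis by simp
  qed
  have ln_N: "ln (real (?N n)) \<le> ln K + n * ln 2" for n
  proof -
    have "ln (real (K * 2 ^ n)) = ln K + n * ln 2" using K by (simp add: ln_mult ln_realpow)
    moreover have "ln (real (?N n)) \<le> ln (real (K * 2 ^ n))"
    \<comment> \<open>By convention \<open>ln 0 = 0\<close>, so monotonicity of the logarithm does
      not cover a zero count; there the bound follows from K * 2^n being at least 1.\<close>
    proof (cases "?N n = 0")
      case True
      have "1 \<le> K * 2 ^ n" using K by (simp add: Suc_le_eq)
      then have "1 \<le> real (K * 2 ^ n)" by (metis of_nat_1 of_nat_mono)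
      then show ?thesis using True by (simp del: of_nat_mult)
    next
      case False
      moreover have "real (?N n) \<le> real (K * 2 ^ n)" using N of_nat_mono by blast
      ultimately show ?thesis by (intro ln_mono) auto
    qed
    ultimately show ?thesis by simp
  qed
  have "(\<lambda>n. ereal (ln K / n + ln 2)) \<longlonglongrightarrow> ereal (0 + ln 2)"
    by (intro tendsto_intros lim_const_over_n)
  then have lim: "limsup (\<lambda>n. ereal (ln K / n + ln 2)) = ereal (ln 2)"
    by (simp add: lim_imp_Limsup)
  have "ln (real (?N n)) / n \<le> ln K / n + ln 2" if "n > 0" for n
    using ln_N[of n] that by (simp add: field_simps)
  then have "\<forall>\<^sub>F n in sequentially. ereal (ln (real (?N n)) / n) \<le> ereal (ln K / n + ln 2)"
    by (intro eventually_sequentiallyI[of 1]) simp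
  then show ?thesis unfolding cover_entropy_def lim[symmetric] by (rule Limsup_mono)
qed

text \<open>The restriction to the S-integers of the character of the rationals with frequency t.
  Its value at 1 can be any point of the circle, which provides separated orbits for the lower
  entropy bound.\<close>

definition rotation_character :: "nat set \<Rightarrow> real \<Rightarrow> rat \<Rightarrow> complex" where
  "rotation_character S t = (\<lambda>r\<in>S_integers S. cis (2 * pi * t * of_rat r))"

lemma rotation_character_in_S_dual: "rotation_character S t \<in> S_dual S"
  by (auto simp: rotation_character_def unitary_characters_def S_integers_add cis_mult of_rat_add distrib_left)

text \<open>Write j - l = 2^a * b with b odd. After i = n - 1 - a doublings the phase difference 2
  pi (j - l) / 2^n has become pi * b, half a turn.\<close>

lemma dyadic_rotations_antipodal:
  fixes j l n :: nat
  assumes "l < j" "j < 2 ^ n"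
  shows "\<exists>i<n. cis (2 * pi * (real j / 2 ^ n)) ^ (2 ^ i) = - (cis (2 * pi * (real l / 2 ^ n)) ^ (2 ^ i))"
proof -
  obtain b where b: "j - l = 2 ^ multiplicity 2 (j - l) * b" "odd b"
  proof (rule multiplicity_decompose'[of "j - l" 2])
    show "j - l \<noteq> 0" using assms by simp
  qed (simp, blast)
  define a where "a = multiplicity 2 (j - l)"
  have ab: "j - l = 2 ^ a * b" "odd b" using b by (simp_all add: a_def)
  have "2 ^ a \<le> j - l" using ab assms by (intro dvd_imp_le) (simp, linarith)
  then have "(2::nat) ^ a < 2 ^ n" using assms by linarith
  then have a: "a < n" by (rule power_less_imp_less_exp[rotated]) simp
  have j: "real j = real l + 2 ^ a * real b" 
  proof -
    have "j = l + 2 ^ a * b" using ab(1) assms by simp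
    then show ?thesis by simp
  qed
  define i where "i = n - Suc a"
  have n: "n = Suc (a + i)" using a by (simp add: i_def)
  have "real (2 ^ i) * (2 * pi * (real j / 2 ^ n)) = real (2 ^ i) * (2 * pi * (real l / 2 ^ n)) + pi * real b"
    unfolding n j by (simp add: field_simps power_add)
  moreover have "cis (pi * real b) = -1" using ab(2) by (auto simp: cis.ctr complex_eq_iff elim!: oddE)
  ultimately have "cis (2 * pi * (real j / 2 ^ n)) ^ (2 ^ i) = - (cis (2 * pi * (real l / 2 ^ n)) ^ (2 ^ i))"
    by (simp add: Complex.DeMoivre flip: cis_mult)
  moreover have "i < n" using n by simp
  ultimately show ?thesis by blast
qed

text \<open>Cover the dual by four open half-plane conditions on \<open>\<xi> 1\<close>. Antipodal
  points never share an open half-plane through 0, so the 2^n rotation characters with dyadic angles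
  lie in pairwise different members of any subcover of the n-th join.\<close>

lemma cover_entropy_ge:
  "\<exists>\<U>. is_open_cover (dual_space (S_integers S)) \<U> \<and>
     ereal (ln 2) \<le> cover_entropy (dual_space (S_integers S)) (S_integer_map S) \<U>"
proof -
  let ?X = "dual_space (S_integers S)" and ?T = "S_integer_map S"
  define H where "H = (\<lambda>c. {\<xi> \<in> topspace ?X. \<xi> 1 \<in> {z. 0 < Re (c * z)}})"
  define \<U> where "\<U> = H ` {1, -1, \<i>, -\<i>}"
  have opn: "openin ?X (H c)" for c
    unfolding H_def
    by (intro openin_continuous_map_preimage[where Y = euclidean] continuous_map_eval)
      (auto intro!: open_Collect_less continuous_intros)
  have "\<Union>\<U> = topspace ?X"
  proof
    show "\<Union>\<U> \<subseteq> topspace ?X" by (auto simp: \<U>_def H_def)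
    show "topspace ?X \<subseteq> \<Union>\<U>"
    proof
      fix \<xi> assume \<xi>: "\<xi> \<in> topspace ?X"
      have "\<xi> 1 \<noteq> 0" using character_norm[of \<xi> _ 1] \<xi> by force
      then have "Re (\<xi> 1) > 0 \<or> Re (\<xi> 1) < 0 \<or> Im (\<xi> 1) > 0 \<or> Im (\<xi> 1) < 0"
        by (auto simp: complex_eq_iff)
      then show "\<xi> \<in> \<Union>\<U>" using \<xi> by (auto simp: \<U>_def H_def)
    qed
  qed
  then have cover: "is_open_cover ?X \<U>"
    unfolding is_open_cover_def \<U>_def using opn by blast
  have N: "2 ^ n \<le> min_subcover_card ?X (iterated_join ?X ?T \<U> n)" for n
  proof -
    obtain \<V> where \<V>: "\<V> \<subseteq> iterated_join ?X ?T \<U> n" "finite \<V>" "\<Union>\<V> = S_dual S"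
        and card: "card \<V> = min_subcover_card ?X (iterated_join ?X ?T \<U> n)"
      using min_subcover_card_attained[OF cover, of n] by (elim exE conjE) (rule that)
    define p where "p = (\<lambda>j::nat. rotation_character S (real j / 2 ^ n))"
    have p: "p j \<in> S_dual S" for j by (simp add: p_def rotation_character_in_S_dual)
    define v where "v = (\<lambda>j. SOME V. V \<in> \<V> \<and> p j \<in> V)"
    have "\<exists>V. V \<in> \<V> \<and> p j \<in> V" for j using p[of j] unfolding \<V>(3)[symmetric] by blast
    then have v: "\<And>j. v j \<in> \<V>" "\<And>j. p j \<in> v j"
      unfolding v_def by (metis (mono_tags, lifting) someI_ex)+
    have neq: "v j \<noteq> v l" if jl: "l < j" "j < 2 ^ n" for j l
    proof
      assume eq: "v j = v l"
      obtain i where i: "i < n" "p j 1 ^ (2 ^ i) = - (p l 1 ^ (2 ^ i))"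
        using dyadic_rotations_antipodal[OF jl] by (auto simp: p_def rotation_character_def)
      obtain U where U: "v j = {x \<in> topspace ?X. \<forall>i<n. (?T ^^ i) x \<in> U i}" "\<forall>i<n. U i \<in> \<U>"
        using v(1)[of j] \<V>(1) by (auto simp: iterated_join_def)
      have mem: "(?T ^^ i) (p j) \<in> U i" "(?T ^^ i) (p l) \<in> U i"
        using v(2)[of j] v(2)[of l] eq U(1) i(1) by auto
      obtain c where "U i = H c" using U(2) i(1) by (auto simp: \<U>_def)
      then have "0 < Re (c * (p j 1 ^ (2 ^ i)))" "0 < Re (c * (p l 1 ^ (2 ^ i)))"
        using mem p by (auto simp: H_def S_integer_map_funpow_apply)
      then show False unfolding i(2) by simp
    qed
    have "inj_on v {..<2 ^ n}"
    proof (rule inj_onI)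
      fix j l assume "j \<in> {..<2 ^ n}" "l \<in> {..<2 ^ n}" "v j = v l"
      then show "j = l" using neq[of j l] neq[of l j] by (cases j l rule: linorder_cases) auto
    qed
    then have "card {..<2 ^ n :: nat} \<le> card \<V>"
      using v(1) \<V>(2) by (intro card_inj_on_le) auto
    then show ?thesis using card by simp
  qed
  have "ln 2 \<le> ln (real (min_subcover_card ?X (iterated_join ?X ?T \<U> n))) / n" if "n > 0" for n
  proof -
    have "ln (2 ^ n :: real) \<le> ln (real (min_subcover_card ?X (iterated_join ?X ?T \<U> n)))"
      using N[of n] by (intro ln_mono) (auto simp flip: of_nat_le_iff)
    then show ?thesis using that by (simp add: ln_realpow field_simps)
  qed
  then have ev: "\<forall>\<^sub>F n in sequentially. ereal (ln 2) \<le>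
      ereal (ln (real (min_subcover_card ?X (iterated_join ?X ?T \<U> n))) / n)"
    by (intro eventually_sequentiallyI[of 1]) simp
  have "ereal (ln 2) = limsup (\<lambda>n. ereal (ln 2))" by (simp add: Limsup_const)
  also have "\<dots> \<le> cover_entropy ?X ?T \<U>"
    unfolding cover_entropy_def using ev by (rule Limsup_mono)
  finally show ?thesis using cover by blast
qed

theorem topological_entropy_S_integer_map:
  "topological_entropy (dual_space (S_integers S)) (S_integer_map S) = ereal (ln 2)"
  unfolding topological_entropy_def
proof (rule antisym)
  show "(SUP \<U>\<in>{\<U>. is_open_cover (dual_space (S_integers S)) \<U>}.
      cover_entropy (dual_space (S_integers S)) (S_integer_map S) \<U>) \<le> ereal (ln 2)"
    using cover_entropy_le by (intro SUP_least) auto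
  obtain \<U> where "is_open_cover (dual_space (S_integers S)) \<U>"
      "ereal (ln 2) \<le> cover_entropy (dual_space (S_integers S)) (S_integer_map S) \<U>"
    using cover_entropy_ge by blast
  then show "ereal (ln 2) \<le> (SUP \<U>\<in>{\<U>. is_open_cover (dual_space (S_integers S)) \<U>}.
      cover_entropy (dual_space (S_integers S)) (S_integer_map S) \<U>)"
    by (auto intro: SUP_upper2)
qed

section \<open>Closed orbits and periodic points\<close>

text \<open>Each point of a closed orbit generates all of it, so the orbit is recovered from any of
  its points and two closed orbits that meet are equal.\<close>

lemma closed_orbit_subset_periodic:
  assumes T: "\<And>x. x \<in> X \<Longrightarrow> T x \<in> X" and \<tau>: "closed_orbit X T n \<tau>" and y: "y \<in> \<tau>"
  shows "n > 0" "y \<in> X" "(T ^^ n) y = y" "\<tau> = range (\<lambda>i. (T ^^ i) y)" "card \<tau> = n"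
proof -
  obtain x where x: "x \<in> X" "(T ^^ n) x = x" "\<tau> = (\<lambda>i. (T ^^ i) x) ` {0..n}" "card \<tau> = n"
    using \<tau> by (auto simp: closed_orbit_def)
  show card: "card \<tau> = n" by fact
  \<comment> \<open>Index 0 puts x itself into the image, so its cardinality n cannot be 0.\<close>
  show n: "n > 0" using x(3) card by (metis card_gt_0_iff atLeastAtMost_iff empty_iff finite_atLeastAtMost
        finite_imageI image_is_empty le0 order_refl)
  have red: "(T ^^ (i mod n)) x = (T ^^ i) x" for i using x(2) by (rule funpow_mod_eq)
  have \<tau>x: "\<tau> = range (\<lambda>i. (T ^^ i) x)"
  proof
    show "range (\<lambda>i. (T ^^ i) x) \<subseteq> \<tau>"
    proof clarify
      fix i show "(T ^^ i) x \<in> \<tau>"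
        unfolding x(3) using red[of i] n by (intro image_eqI[of _ _ "i mod n"]) auto
    qed
  qed (use x(3) in auto)
  obtain i where i: "y = (T ^^ i) x" using y \<tau>x by auto
  have XT: "(T ^^ j) x \<in> X" for j by (induction j) (use x T in auto)
  then show "y \<in> X" by (simp add: i)
  have "(T ^^ n) ((T ^^ i) x) = (T ^^ i) ((T ^^ n) x)"
    by (simp add: add.commute flip: funpow_add comp_apply[of "T ^^ _" "T ^^ _" x])
  then show "(T ^^ n) y = y" by (simp add: i x(2))
  show "\<tau> = range (\<lambda>i. (T ^^ i) y)"
  proof
    show "range (\<lambda>i. (T ^^ i) y) \<subseteq> \<tau>"
      by (auto simp: i \<tau>x simp flip: funpow_add comp_apply[of "T ^^ _" "T ^^ _" x])
    show "\<tau> \<subseteq> range (\<lambda>i. (T ^^ i) y)"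
      unfolding \<tau>x
    proof clarify
      fix j
      \<comment> \<open>From the i-th iterate of x, another n - i mod n steps lead back to x, and j
        more reach the desired point.\<close>
      have "(T ^^ (j + (n - i mod n))) y = (T ^^ (j + (n - i mod n) + i)) x"
        by (simp add: i funpow_add)
      also have "\<dots> = (T ^^ ((j + (n - i mod n) + i) mod n)) x" by (simp only: red)
      also have "(j + (n - i mod n) + i) mod n = j mod n"
      proof -
        have "i = n * (i div n) + i mod n" by simp
        then have "j + (n - i mod n) + i = j + n * (i div n + 1)"
          using mod_less_divisor[OF n, of i] by (simp only: distrib_left)
        then show ?thesis by (simp only: mod_mult_self2)
      qed
      also have "(T ^^ (j mod n)) x = (T ^^ j) x" by (rule red)
      finally show "(T ^^ j) x \<in> range (\<lambda>i. (T ^^ i) y)" by (metis rangeI)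
    qed
  qed
qed

text \<open>Closed orbits of length n are pairwise disjoint sets of n points each, all fixed by the
  n-th iterate.\<close>

lemma card_closed_orbits:
  assumes T: "\<And>x. x \<in> X \<Longrightarrow> T x \<in> X"
    and fin: "finite {x \<in> X. (T ^^ n) x = x}" and n: "n > 0"
  shows "finite {\<tau>. closed_orbit X T n \<tau>}"
    and "card (\<Union>{\<tau>. closed_orbit X T n \<tau>}) = n * card {\<tau>. closed_orbit X T n \<tau>}"
    and "\<Union>{\<tau>. closed_orbit X T n \<tau>} \<subseteq> {x \<in> X. (T ^^ n) x = x}"
proof -
  note sub = closed_orbit_subset_periodic[of X T, OF T]
  show U: "\<Union>{\<tau>. closed_orbit X T n \<tau>} \<subseteq> {x \<in> X. (T ^^ n) x = x}"
  proof
    fix x assume "x \<in> \<Union>{\<tau>. closed_orbit X T n \<tau>}"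
    then obtain \<tau> where "closed_orbit X T n \<tau>" "x \<in> \<tau>" by blast
    then show "x \<in> {x \<in> X. (T ^^ n) x = x}" using sub(2,3) by simp
  qed
  then show "finite {\<tau>. closed_orbit X T n \<tau>}"
    using fin by (meson finite_UnionD finite_subset)
  have "pairwise disjnt {\<tau>. closed_orbit X T n \<tau>}"
  proof (rule pairwiseI, rule ccontr)
    fix \<tau> \<tau>' assume \<tau>: "\<tau> \<in> {\<tau>. closed_orbit X T n \<tau>}" "\<tau>' \<in> {\<tau>. closed_orbit X T n \<tau>}"
      and ne: "\<tau> \<noteq> \<tau>'" "\<not> disjnt \<tau> \<tau>'"
    obtain y where "y \<in> \<tau>" "y \<in> \<tau>'" using ne(2) by (auto simp: disjnt_iff)
    then show False using sub(4)[of n \<tau> y] sub(4)[of n \<tau>' y] \<tau> ne(1) by simp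
  qed
  moreover have "finite \<tau>" if "closed_orbit X T n \<tau>" for \<tau>
    using that by (auto simp: closed_orbit_def)
  ultimately have "card (\<Union>{\<tau>. closed_orbit X T n \<tau>}) = sum card {\<tau>. closed_orbit X T n \<tau>}"
    by (intro card_Union_disjoint) auto
  also have "\<dots> = (\<Sum>\<tau>\<in>{\<tau>. closed_orbit X T n \<tau>}. n)"
    by (intro sum.cong) (auto simp: closed_orbit_def)
  finally show "card (\<Union>{\<tau>. closed_orbit X T n \<tau>}) = n * card {\<tau>. closed_orbit X T n \<tau>}" by simp
qed

text \<open>The least period d divides n. Either d = n and the orbit of x is closed of length n, or
  d is a proper divisor and hence at most n / 2.\<close>

lemma periodic_point_cases:
  assumes x: "x \<in> X" "(T ^^ n) x = x" and n: "n > 0"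
  shows "x \<in> \<Union>{\<tau>. closed_orbit X T n \<tau>} \<or> (\<exists>d\<in>{1..n div 2}. (T ^^ d) x = x)"
proof -
  define d where "d = (LEAST d. 0 < d \<and> (T ^^ d) x = x)"
  have d: "0 < d" "(T ^^ d) x = x"
    using LeastI[of "\<lambda>d. 0 < d \<and> (T ^^ d) x = x" n] x n by (auto simp: d_def)
  have least: "(T ^^ e) x \<noteq> x" if "0 < e" "e < d" for e
    using not_less_Least[of e "\<lambda>d. 0 < d \<and> (T ^^ d) x = x"] that by (auto simp: d_def)
  have "(T ^^ (n mod d)) x = x" using funpow_mod_eq[OF d(2), of n] x by simp
  then have "d dvd n" using least[of "n mod d"] d by (auto simp: dvd_eq_mod_eq_0)
  then obtain e where e: "n = d * e" by auto
  show ?thesis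
  proof (cases "e = 1")
    case True
    then have "n = d" using e by simp
    have inj: "inj_on (\<lambda>i. (T ^^ i) x) {0..<n}"
      using x(2) least \<open>n = d\<close> by (intro inj_on_funpow_least) auto
    have "(\<lambda>i. (T ^^ i) x) ` {0..n} = (\<lambda>i. (T ^^ i) x) ` {0..<n}"
    proof -
      have "{0..n} = insert n {0..<n}" by auto
      moreover have "(T ^^ n) x \<in> (\<lambda>i. (T ^^ i) x) ` {0..<n}"
        using x n by (intro image_eqI[of _ _ 0]) auto
      ultimately show ?thesis by (metis image_insert insert_absorb)
    qed
    then have "closed_orbit X T n ((\<lambda>i. (T ^^ i) x) ` {0..n})"
      using x card_image[OF inj] unfolding closed_orbit_def by (intro bexI[of _ x]) simp_all
    moreover have "x \<in> (\<lambda>i. (T ^^ i) x) ` {0..n}" by (intro image_eqI[of _ _ 0]) auto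
    ultimately show ?thesis by blast
  next
    case False
    then have "e \<ge> 2" using e n by (cases e) auto
    then have "d * 2 \<le> n" unfolding e by (rule mult_le_mono2)
    then have "d \<in> {1..n div 2}" using d by auto
    then show ?thesis using d by blast
  qed
qed

text \<open>This takes the place of Moebius inversion: summing over all d up to n / 2 instead of the
  proper divisors is crude, but the sum is still of order 2^(n / 2) in the application.\<close>

lemma periodic_points_le_closed_orbits:
  assumes T: "\<And>x. x \<in> X \<Longrightarrow> T x \<in> X"
    and fin: "\<And>n. n > 0 \<Longrightarrow> finite {x \<in> X. (T ^^ n) x = x}" and n: "n > 0"
  shows "card {x \<in> X. (T ^^ n) x = x}
    \<le> n * card {\<tau>. closed_orbit X T n \<tau>} + (\<Sum>d=1..n div 2. card {x \<in> X. (T ^^ d) x = x})"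
proof -
  let ?P = "\<lambda>n. {x \<in> X. (T ^^ n) x = x}" and ?U = "\<Union>{\<tau>. closed_orbit X T n \<tau>}"
  note orb = card_closed_orbits[OF T fin[OF n] n]
  have "?P n \<subseteq> ?U \<union> (\<Union>d\<in>{1..n div 2}. ?P d)"
    using periodic_point_cases[OF _ _ n, of _ X T] by blast
  moreover have "finite ?U" using orb(3) fin[OF n] by (rule finite_subset)
  ultimately have "card (?P n) \<le> card (?U \<union> (\<Union>d\<in>{1..n div 2}. ?P d))"
    using fin by (intro card_mono) auto
  also have "\<dots> \<le> card ?U + card (\<Union>d\<in>{1..n div 2}. ?P d)" by (rule card_Un_le)
  also have "card (\<Union>d\<in>{1..n div 2}. ?P d) \<le> (\<Sum>d=1..n div 2. card (?P d))"
    by (rule card_UN_le) simp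
  finally show ?thesis using orb(2) by simp
qed

section \<open>Periodic characters and roots of unity\<close>

lemma power_int_cong:
  fixes z :: complex
  assumes "z ^ m = 1" "m > 0" "int m dvd a - b"
  shows "z powi a = z powi b"
proof -
  obtain k where k: "a = b + int m * k" using assms(3) by (metis add.commute diff_add_cancel dvdE)
  have z: "z \<noteq> 0" using assms by (auto simp: power_0_left)
  have "z powi (int m * k) = 1" using assms(1) by (simp add: power_int_mult)
  then show ?thesis unfolding k using z by (simp add: power_int_add)
qed

lemma character_of_int:
  assumes "\<xi> \<in> S_dual S" shows "\<xi> (of_int a) = \<xi> 1 powi a"
proof (cases "a \<ge> 0")
  case True
  then show ?thesis using character_of_nat_mult[OF assms S_integers_1, of "nat a"]
    by (simp add: power_int_def)
next
  case False
  have "\<xi> (of_int a) = \<xi> (- of_nat (nat (- a)))" using False by simp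
  also have "\<dots> = cnj (\<xi> 1 ^ nat (- a))"
    using character_uminus[OF assms S_integers_of_nat] character_of_nat_mult[OF assms S_integers_1, of "nat (- a)"]
    by simp
  also have "\<dots> = inverse (\<xi> 1) ^ nat (- a)"
    using character_norm[OF assms S_integers_1]
    by (simp add: inverse_eq_divide complex_div_cnj[of 1])
  finally show ?thesis using False by (simp add: power_int_def)
qed

text \<open>Bezout inverts the denominator modulo m, so every S-integer is congruent to an integer
  modulo m. With the next lemma this identifies the quotient of the S-integers by their multiples of
  m with Z/m.\<close>

lemma S_integer_residue:
  assumes m: "\<And>b. S_number S b \<Longrightarrow> coprime m b" and r: "r \<in> S_integers S"
  shows "\<exists>x::int. \<exists>t\<in>S_integers S. r = of_int x + of_nat m * t"
proof -
  obtain a b where b: "S_number S b" "r = of_int a / of_nat b" using r by (rule S_integersE)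
  have "coprime (int b) (int m)" using m[OF b(1)] by (simp add: coprime_commute)
  then obtain u v where uv: "u * int b + v * int m = 1"
    using bezout_int[of "int b" "int m"] by auto
  have "(of_int (u * int b + v * int m) :: rat) = 1" by (simp only: uv of_int_1)
  then have 1: "of_int u * of_nat b + of_int v * of_nat m = (1::rat)" by simp
  have "r = of_int a * (of_int u * of_nat b + of_int v * of_nat m) / of_nat b"
    unfolding 1 using b by simp
  also have "\<dots> = of_int (a * u) + of_nat m * (of_int (a * v) / of_nat b)"
    using S_number_pos[OF b(1)] by (simp add: field_simps)
  finally show ?thesis using S_integers_of_int_div[OF b(1)] by blast
qed

lemma S_integer_residue_unique:
  assumes m: "\<And>b. S_number S b \<Longrightarrow> coprime m b" and t: "t \<in> S_integers S"
    and x: "of_int x = of_nat m * t"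
  shows "int m dvd x"
proof -
  obtain a b where b: "S_number S b" "t = of_int a / of_nat b" using t by (rule S_integersE)
  have "(of_int (x * int b) :: rat) = of_int (int m * a)"
    using x b S_number_pos[OF b(1)] by (simp add: field_simps)
  then have "x * int b = int m * a" by (simp only: of_int_eq_iff)
  then have "int m dvd x * int b" by simp
  then show ?thesis using m[OF b(1)] by (simp add: coprime_dvd_mult_left_iff)
qed

text \<open>A character fixed by the n-th iterate is trivial on multiples of 2^n - 1 = m * s. As s
  is invertible among the S-integers, it is trivial on multiples of m and so determined by its value
  at 1.\<close>

lemma periodic_character_apply:
  assumes \<xi>: "\<xi> \<in> S_dual S" "(S_integer_map S ^^ n) \<xi> = \<xi>"
    and s: "S_number S s" "2 ^ n - 1 = m * s" and t: "t \<in> S_integers S"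
  shows "\<xi> (of_int x + of_nat m * t) = \<xi> 1 powi x"
proof -
  \<comment> \<open>Dividing by the unit s gives (2^n - 1) * \<open>?y\<close> = m * t.\<close>
  let ?y = "t * (1 / of_nat s)"
  have y: "?y \<in> S_integers S" using t s by (intro S_integers_mult S_integers_inverse)
  have "\<xi> (2 ^ n * ?y) = \<xi> ?y"
    using fun_cong[OF \<xi>(2), of ?y] y by (simp add: S_integer_map_funpow[OF \<xi>(1)])
  moreover have "of_nat (2 ^ n) = (of_nat (m * s + 1) :: rat)" unfolding s(2)[symmetric] by simp
  then have "2 ^ n = (of_nat m * of_nat s + 1 :: rat)" by simp
  then have "2 ^ n * ?y = ?y + of_nat m * t" using S_number_pos[OF s(1)] by (simp add: field_simps)
  moreover have mt: "of_nat m * t \<in> S_integers S" using t by (intro S_integers_mult) auto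
  ultimately have "\<xi> ?y * \<xi> (of_nat m * t) = \<xi> ?y" using character_add[OF \<xi>(1) y mt] by simp
  then have "\<xi> (of_nat m * t) = 1" using character_norm[OF \<xi>(1) y] by auto
  then show ?thesis using character_add[OF \<xi>(1) S_integers_of_int mt] character_of_int[OF \<xi>(1)] by simp
qed

text \<open>Send r to z^x for an integer x congruent to r modulo m. Since z^m = 1, the value depends
  only on the residue class, and 2^n = 1 modulo m makes the character periodic.\<close>

lemma periodic_character_exists:
  assumes m: "\<And>b. S_number S b \<Longrightarrow> coprime m b" "m > 0"
    and s: "2 ^ n - 1 = m * s" and z: "z ^ m = 1"
  shows "\<exists>\<xi>\<in>S_dual S. (S_integer_map S ^^ n) \<xi> = \<xi> \<and> \<xi> 1 = z"
proof -
  define c where "c = (\<lambda>r. SOME x::int. \<exists>t\<in>S_integers S. r = of_int x + of_nat m * t)"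
  have c: "\<exists>t. t \<in> S_integers S \<and> r = of_int (c r) + of_nat m * t" if "r \<in> S_integers S" for r
    using someI_ex[OF S_integer_residue[OF m(1) that]] unfolding c_def Bex_def .
  define t where "t = (\<lambda>r. SOME t. t \<in> S_integers S \<and> r = of_int (c r) + of_nat m * t)"
  have tc: "t r \<in> S_integers S \<and> r = of_int (c r) + of_nat m * t r" if "r \<in> S_integers S" for r
    unfolding t_def by (rule someI_ex[OF c[OF that]])
  have t: "t r \<in> S_integers S" "of_int (c r) = r - of_nat m * t r" if "r \<in> S_integers S" for r
    using conjunct1[OF tc[OF that]] conjunct2[OF tc[OF that]] by - (assumption, linarith)
  define \<xi> where "\<xi> = (\<lambda>r\<in>S_integers S. z powi c r)"
  have z0: "z \<noteq> 0" using z m(2) by (auto simp: power_0_left)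
  have "norm z ^ m = 1 ^ m" using arg_cong[OF z, of norm] by (simp add: norm_power)
  then have nz: "norm z = 1" by (rule power_eq_imp_eq_base) (simp_all add: m(2))
  \<comment> \<open>Independence of the chosen residue: any representation of r may be used to
    evaluate \<xi>. Additivity and periodicity both rest on this.\<close>
  have \<xi>I: "\<xi> r = z powi x" if r: "r \<in> S_integers S" and u: "u \<in> S_integers S" "r = of_int x + of_nat m * u" for r x u
  proof -
    have "of_int (c r - x) = of_nat m * (u - t r)"
      using t(2)[OF r] unfolding u(2)[symmetric] of_int_diff right_diff_distrib using u(2) by linarith
    with m(1) S_integers_diff[OF u(1) t(1)[OF r]] have "int m dvd c r - x"
      by (rule S_integer_residue_unique)
    then have "z powi c r = z powi x" by (rule power_int_cong[OF z m(2)])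
    then show ?thesis using r by (simp add: \<xi>_def)
  qed
  have "\<xi> (r + r') = \<xi> r * \<xi> r'" if r: "r \<in> S_integers S" "r' \<in> S_integers S" for r r'
  proof -
    have "\<xi> (r + r') = z powi (c r + c r')"
    proof (rule \<xi>I)
      show "r + r' = of_int (c r + c r') + of_nat m * (t r + t r')"
        using t(2)[OF r(1)] t(2)[OF r(2)] by (simp add: distrib_left)
    qed (use r t(1) in \<open>auto intro: S_integers_add\<close>)
    then show ?thesis using r z0 by (simp add: \<xi>_def power_int_add)
  qed
  then have \<xi>: "\<xi> \<in> S_dual S"
    unfolding unitary_characters_def using nz by (auto simp: \<xi>_def norm_power_int)
  moreover have "\<xi> 1 = z" using \<xi>I[of 1 0 1] by simp
  moreover have "(S_integer_map S ^^ n) \<xi> = \<xi>"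
  proof (rule extensionalityI[of _ "S_integers S"])
    fix r assume r: "r \<in> S_integers S"
    have "of_nat (2 ^ n) = (of_nat (m * s + 1) :: rat)" unfolding s[symmetric] by simp
    then have n: "2 ^ n = (of_nat m * of_nat s + 1 :: rat)" by simp
    have "\<xi> (2 ^ n * r) = z powi c r"
    proof (rule \<xi>I)
      show "2 ^ n * r = of_int (c r) + of_nat m * (t r + of_nat s * r)"
        unfolding t(2)[OF r] n by (simp add: algebra_simps)
    qed (intro r t(1) S_integers_add S_integers_power_mult S_integers_mult S_integers_of_nat)+
    then show "(S_integer_map S ^^ n) \<xi> r = \<xi> r"
      using r by (simp add: S_integer_map_funpow[OF \<xi>]) (simp add: \<xi>_def)
  qed (intro character_extensional[OF S_integer_map_funpow_in_S_dual[OF \<xi>]], rule character_extensional[OF \<xi>])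
  ultimately show ?thesis by blast
qed

text \<open>Evaluation at 1 is a bijection from the characters fixed by the n-th iterate onto the
  m-th roots of unity.\<close>

lemma card_periodic_characters:
  assumes m: "\<And>b. S_number S b \<Longrightarrow> coprime m b" "m > 0"
    and s: "S_number S s" "2 ^ n - 1 = m * s"
  shows "finite {\<xi> \<in> S_dual S. (S_integer_map S ^^ n) \<xi> = \<xi>}"
    and "card {\<xi> \<in> S_dual S. (S_integer_map S ^^ n) \<xi> = \<xi>} = m"
proof -
  let ?P = "{\<xi> \<in> S_dual S. (S_integer_map S ^^ n) \<xi> = \<xi>}"
  have inj: "inj_on (\<lambda>\<xi>. \<xi> 1) ?P"
  proof (rule inj_onI)
    fix \<xi> \<eta> assume P: "\<xi> \<in> ?P" "\<eta> \<in> ?P" and eq: "\<xi> 1 = \<eta> 1"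
    show "\<xi> = \<eta>"
    proof (rule extensionalityI[of _ "S_integers S"])
      fix r assume "r \<in> S_integers S"
      then obtain x t where "t \<in> S_integers S" "r = of_int x + of_nat m * t"
        using S_integer_residue[OF m(1)] by blast
      then show "\<xi> r = \<eta> r"
        using P eq periodic_character_apply[OF _ _ s, of \<xi> t x] periodic_character_apply[OF _ _ s, of \<eta> t x]
        by simp
    qed (use P character_extensional in auto)
  qed
  have img: "(\<lambda>\<xi>. \<xi> 1) ` ?P = {z. z ^ m = 1}"
  proof
    show "(\<lambda>\<xi>. \<xi> 1) ` ?P \<subseteq> {z. z ^ m = 1}"
    proof clarify
      fix \<xi> assume \<xi>: "\<xi> \<in> S_dual S" "(S_integer_map S ^^ n) \<xi> = \<xi>"
      have "\<xi> 1 ^ m = \<xi> (of_nat m)" using character_of_nat_mult[OF \<xi>(1) S_integers_1, of m] by simp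
      also have "\<dots> = 1" using periodic_character_apply[OF \<xi> s S_integers_1, of 0] by simp
      finally show "\<xi> 1 ^ m = 1" .
    qed
    show "{z. z ^ m = 1} \<subseteq> (\<lambda>\<xi>. \<xi> 1) ` ?P"
      using periodic_character_exists[OF m s(2)] by (force simp: image_iff)
  qed
  have fin: "finite {z::complex. z ^ m = 1}" using m(2) by (intro finite_roots_unity) auto
  show "finite ?P" using finite_imageD[OF _ inj] img fin by simp
  show "card ?P = m" using card_image[OF inj] img card_roots_unity_eq[OF m(2)] by simp
qed

section \<open>Cesaro and logarithmic means\<close>

definition cesaro :: "(nat \<Rightarrow> real) \<Rightarrow> nat \<Rightarrow> real" where
  "cesaro f N = (\<Sum>n=1..N. f n) / real N"

lemma cesaro_diff: "cesaro f N - cesaro g N = cesaro (\<lambda>n. f n - g n) N"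
  by (simp add: cesaro_def sum_subtractf diff_divide_distrib)

lemma cesaro_mono:
  assumes "\<And>n. n \<ge> 1 \<Longrightarrow> f n \<le> g n" shows "cesaro f N \<le> cesaro g N"
  unfolding cesaro_def using assms by (intro divide_right_mono sum_mono) auto

lemma cesaro_const: "N > 0 \<Longrightarrow> cesaro (\<lambda>_. c) N = c"
  by (simp add: cesaro_def)

lemma cesaro_abs_diff_le:
  assumes "\<And>n. n \<ge> 1 \<Longrightarrow> \<bar>f n - g n\<bar> \<le> e" "N > 0"
  shows "\<bar>cesaro f N - cesaro g N\<bar> \<le> e"
proof -
  have "\<bar>\<Sum>n=1..N. f n - g n\<bar> \<le> (\<Sum>n=1..N. \<bar>f n - g n\<bar>)" by (rule sum_abs)
  also have "\<dots> \<le> (\<Sum>n=1..N. e)" using assms by (intro sum_mono) auto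
  also have "\<dots> = e * N" by simp
  finally show ?thesis using assms(2)
    unfolding cesaro_diff unfolding cesaro_def by (simp add: pos_divide_le_eq)
qed

text \<open>After subtracting the mean over one period, the partial sums are themselves periodic,
  hence bounded, and vanish when divided by N.\<close>

lemma cesaro_periodic:
  fixes g :: "nat \<Rightarrow> real"
  assumes m: "m > 0" and per: "\<And>n. g (n + m) = g n"
  shows "cesaro g \<longlonglongrightarrow> (\<Sum>n=1..m. g n) / m"
proof -
  define c where "c = (\<Sum>n=1..m. g n) / m"
  define G where "G = (\<lambda>N. \<Sum>n=1..N. g n - c)"
  have "G m = 0" using m by (simp add: G_def c_def sum_subtractf)
  have per1: "G (N + m) = G N" for N
  proof (induction N)
    case 0 show ?case using \<open>G m = 0\<close> by (simp add: G_def)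
  next
    case (Suc N)
    have "G (Suc N + m) = G (N + m) + (g (Suc N + m) - c)" by (simp add: G_def)
    also have "\<dots> = G N + (g (Suc N) - c)" by (simp only: Suc per)
    finally show ?case by (simp add: G_def)
  qed
  have per': "G (N + k * m) = G N" for N k
  proof (induction k)
    case (Suc k)
    then show ?case using per1[of "N + k * m"] by (simp add: add_ac)
  qed simp
  define B where "B = (\<Sum>N<m. \<bar>G N\<bar>)"
  have bound: "\<bar>G N\<bar> \<le> B" for N
  proof -
    have "G N = G (N mod m)" using per'[of "N mod m" "N div m"] by simp
    moreover have "\<bar>G (N mod m)\<bar> \<le> B"
      unfolding B_def using m by (intro member_le_sum) auto
    ultimately show ?thesis by simp
  qed
  have lim: "(\<lambda>N. G N / real N) \<longlonglongrightarrow> 0"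
  proof (rule Lim_null_comparison)
    show "\<forall>\<^sub>F N in sequentially. norm (G N / real N) \<le> B / real N"
      using bound by (intro always_eventually allI) (auto intro: divide_right_mono)
    show "(\<lambda>N. B / real N) \<longlonglongrightarrow> 0" by (rule lim_const_over_n)
  qed
  have "(\<lambda>N. c + G N / real N) \<longlonglongrightarrow> c + 0" by (intro tendsto_intros lim)
  moreover have "\<forall>\<^sub>F N in sequentially. c + G N / real N = cesaro g N"
    by (intro eventually_sequentiallyI[of 1])
      (simp add: G_def cesaro_def sum_subtractf diff_divide_distrib)
  ultimately show ?thesis unfolding c_def[symmetric] using Lim_transform_eventually by fastforce
qed

text \<open>Uniform limits of periodic functions. Index 0 is exempt from the approximation because
  2^0 - 1 = 0 has multiplicity 0 by convention, while periodicity would treat it as divisible by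
  every power of p.\<close>

definition limit_periodic :: "(nat \<Rightarrow> real) \<Rightarrow> bool" where
  "limit_periodic f \<longleftrightarrow> (\<forall>e>0. \<exists>g m. m > 0 \<and> (\<forall>n. g (n + m) = g n) \<and> (\<forall>n\<ge>1. \<bar>f n - g n\<bar> \<le> e))"

lemma limit_periodic_const: "limit_periodic (\<lambda>_. c)"
  unfolding limit_periodic_def by (intro allI impI exI[of _ "\<lambda>_. c"] exI[of _ 1]) simp

text \<open>Uniformly close functions have uniformly close means, so the Cauchy property is
  inherited from the periodic approximants.\<close>

lemma cesaro_limit_periodic_convergent:
  assumes "limit_periodic f" shows "convergent (cesaro f)"
proof -
  have "Cauchy (cesaro f)"
  proof (rule metric_CauchyI)
    fix e :: real assume "e > 0"
    then have "e / 4 > 0" by simp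
    then obtain g m where "m > 0 \<and> (\<forall>n. g (n + m) = g n) \<and> (\<forall>n\<ge>1. \<bar>f n - g n\<bar> \<le> e / 4)"
      using assms unfolding limit_periodic_def by meson
    then have g: "m > 0" "\<And>n. g (n + m) = g n" "\<And>n. n \<ge> 1 \<Longrightarrow> \<bar>f n - g n\<bar> \<le> e / 4"
      by auto
    have "Cauchy (cesaro g)"
      using cesaro_periodic[of m g] g(1,2) by (intro LIMSEQ_imp_Cauchy) blast
    with \<open>e / 4 > 0\<close> obtain K where K: "\<And>i j. i \<ge> K \<Longrightarrow> j \<ge> K \<Longrightarrow> dist (cesaro g i) (cesaro g j) < e / 4"
      unfolding Cauchy_def by metis
    show "\<exists>M. \<forall>i\<ge>M. \<forall>j\<ge>M. dist (cesaro f i) (cesaro f j) < e"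
    proof (intro exI[of _ "max K 1"] allI impI)
      fix i j assume ij: "i \<ge> max K 1" "j \<ge> max K 1"
      have "\<bar>cesaro f i - cesaro g i\<bar> \<le> e / 4" "\<bar>cesaro f j - cesaro g j\<bar> \<le> e / 4"
        using cesaro_abs_diff_le[OF g(3)] ij by auto
      moreover have "\<bar>cesaro g i - cesaro g j\<bar> < e / 4" using K[of i j] ij by (simp add: dist_real_def)
      ultimately show "dist (cesaro f i) (cesaro f j) < e"
        using \<open>e > 0\<close> unfolding dist_real_def by linarith
    qed
  qed
  then show ?thesis by (rule Cauchy_convergent)
qed

lemma limit_periodic_mult:
  assumes f: "limit_periodic f" "\<And>n. \<bar>f n\<bar> \<le> 1" and h: "limit_periodic h" "\<And>n. \<bar>h n\<bar> \<le> 1"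
  shows "limit_periodic (\<lambda>n. f n * h n)"
  unfolding limit_periodic_def
proof (intro allI impI)
  fix e :: real assume "e > 0"
  \<comment> \<open>With d at most 1 the approximant of f is bounded by 2, so the error of the
    product is at most d + 2 * d.\<close>
  define d where "d = min 1 (e / 3)"
  have d: "d > 0" "d \<le> 1" "3 * d \<le> e" using \<open>e > 0\<close> by (auto simp: d_def)
  obtain g m where "m > 0 \<and> (\<forall>n. g (n + m) = g n) \<and> (\<forall>n\<ge>1. \<bar>f n - g n\<bar> \<le> d)"
    using f(1) d(1) unfolding limit_periodic_def by meson
  then have g: "m > 0" "\<And>n. g (n + m) = g n" "\<And>n. n \<ge> 1 \<Longrightarrow> \<bar>f n - g n\<bar> \<le> d" by auto
  obtain g' m' where "m' > 0 \<and> (\<forall>n. g' (n + m') = g' n) \<and> (\<forall>n\<ge>1. \<bar>h n - g' n\<bar> \<le> d)"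
    using h(1) d(1) unfolding limit_periodic_def by meson
  then have g': "m' > 0" "\<And>n. g' (n + m') = g' n" "\<And>n. n \<ge> 1 \<Longrightarrow> \<bar>h n - g' n\<bar> \<le> d" by auto
  have per: "g (n + k * m) = g n" for n k
  proof (induction k)
    case (Suc k) then show ?case using g(2)[of "n + k * m"] by (simp add: add_ac)
  qed simp
  have per': "g' (n + k * m') = g' n" for n k
  proof (induction k)
    case (Suc k) then show ?case using g'(2)[of "n + k * m'"] by (simp add: add_ac)
  qed simp
  show "\<exists>g m. m > 0 \<and> (\<forall>n. g (n + m) = g n) \<and> (\<forall>n\<ge>1. \<bar>f n * h n - g n\<bar> \<le> e)"
  proof (intro exI conjI allI impI)
    show "m * m' > 0" using g g' by simp
    show "g (n + m * m') * g' (n + m * m') = g n * g' n" for n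
      using per[of n m'] per'[of n m] by (simp add: mult.commute)
    fix n :: nat assume n: "n \<ge> 1"
    have "f n * h n - g n * g' n = (f n - g n) * h n + g n * (h n - g' n)" by (simp add: algebra_simps)
    also have "\<bar>\<dots>\<bar> \<le> \<bar>f n - g n\<bar> * \<bar>h n\<bar> + \<bar>g n\<bar> * \<bar>h n - g' n\<bar>"
      by (simp flip: abs_mult)
    also have "\<dots> \<le> d * 1 + 2 * d"
    proof (intro add_mono mult_mono)
      show "\<bar>g n\<bar> \<le> 2" using g(3)[OF n] f(2)[of n] d(2) by linarith
    qed (use g(3)[OF n] g'(3)[OF n] h(2)[of n] d in auto)
    finally show "\<bar>f n * h n - g n * g' n\<bar> \<le> e" using d by linarith
  qed
qed

lemma limit_periodic_prod:
  assumes "finite A" "\<And>q. q \<in> A \<Longrightarrow> limit_periodic (w q)" "\<And>q n. q \<in> A \<Longrightarrow> \<bar>w q n\<bar> \<le> 1"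
  shows "limit_periodic (\<lambda>n. \<Prod>q\<in>A. w q n) \<and> (\<forall>n. \<bar>\<Prod>q\<in>A. w q n\<bar> \<le> 1)"
  using assms
proof (induction A rule: finite_induct)
  case empty
  then show ?case by (simp add: limit_periodic_const)
next
  case (insert q A)
  have IH: "limit_periodic (\<lambda>n. \<Prod>q\<in>A. w q n)" "\<And>n. \<bar>\<Prod>q\<in>A. w q n\<bar> \<le> 1"
    using insert.IH insert.prems by auto
  have q: "limit_periodic (w q)" "\<And>n. \<bar>w q n\<bar> \<le> 1" using insert.prems by auto
  have "\<bar>w q n * (\<Prod>q\<in>A. w q n)\<bar> \<le> 1" for n
    unfolding abs_mult using q(2) IH(2) by (intro mult_le_one) auto
  then show ?case using limit_periodic_mult[OF q IH] insert.hyps by simp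
qed

section \<open>Logarithmic means\<close>

lemma harm_over_ln: "(\<lambda>N. harm N / ln (real N)) \<longlonglongrightarrow> (1::real)"
proof -
  have ln: "filterlim (\<lambda>N. ln (real N)) at_top sequentially"
    using filterlim_compose[OF ln_at_top filterlim_real_sequentially] by simp
  have "(\<lambda>N. 1 + (harm N - ln (real N)) / ln (real N)) \<longlonglongrightarrow> 1 + (0::real)"
    by (intro tendsto_intros tendsto_divide_0[OF euler_mascheroni_LIMSEQ]
        filterlim_at_top_imp_at_infinity ln)
  moreover have "\<forall>\<^sub>F N in sequentially. 1 + (harm N - ln (real N)) / ln (real N) = harm N / ln (real N)"
    by (intro eventually_sequentiallyI[of 2]) (simp add: diff_divide_distrib)
  ultimately have "(\<lambda>N. harm N / ln (real N)) \<longlonglongrightarrow> 1 + (0::real)"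
    by (rule Lim_transform_eventually)
  then show ?thesis by simp
qed

text \<open>The terms up to n0 contribute a bounded amount \<open>C\<close>, the later ones at most
  r / 4 times the harmonic number, which is asymptotic to ln N.\<close>

lemma harmonic_average_null:
  fixes e :: "nat \<Rightarrow> real"
  assumes e: "e \<longlonglongrightarrow> 0"
  shows "(\<lambda>N. (\<Sum>n=1..N. e n / n) / ln N) \<longlonglongrightarrow> 0"
proof (rule LIMSEQ_I)
  fix r :: real assume r: "r > 0"
  have "r / 4 > 0" using r by simp
  from LIMSEQ_D[OF e this] obtain n0 where "\<forall>n\<ge>n0. norm (e n - 0) < r / 4" by blast
  then have n0: "\<bar>e n\<bar> < r / 4" if "n \<ge> n0" for n using that by simp
  define C where "C = (\<Sum>n=1..n0. \<bar>e n\<bar> / n)"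
  have le: "\<bar>\<Sum>n=1..N. e n / n\<bar> \<le> C + r / 4 * harm N" for N
  proof -
    have "\<bar>\<Sum>n=1..N. e n / n\<bar> \<le> (\<Sum>n=1..N. \<bar>e n / n\<bar>)" by (rule sum_abs)
    also have "\<dots> \<le> (\<Sum>n=1..N. (if n \<le> n0 then \<bar>e n\<bar> / n else 0) + r / 4 * inverse (real n))"
    proof (rule sum_mono)
      fix n assume "n \<in> {1..N}"
      show "\<bar>e n / n\<bar> \<le> (if n \<le> n0 then \<bar>e n\<bar> / n else 0) + r / 4 * inverse (real n)"
      proof (cases "n \<le> n0")
        case True
        have "r / 4 * inverse (real n) \<ge> 0" using r by simp
        then show ?thesis using True by simp
      next
        case False
        then have "\<bar>e n\<bar> * inverse (real n) \<le> r / 4 * inverse (real n)"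
          using n0[of n] by (intro mult_right_mono) auto
        then show ?thesis using False by (simp only: if_False abs_divide abs_of_nat divide_inverse[of "\<bar>e n\<bar>"])
      qed
    qed
    also have "\<dots> = (\<Sum>n=1..N. if n \<le> n0 then \<bar>e n\<bar> / n else 0) + r / 4 * harm N"
      unfolding sum.distrib harm_def sum_distrib_left ..
    also have "(\<Sum>n=1..N. if n \<le> n0 then \<bar>e n\<bar> / n else 0) = (\<Sum>n\<in>{1..N} \<inter> {..n0}. \<bar>e n\<bar> / n)"
      by (subst sum.inter_restrict) (simp_all only: finite_atLeastAtMost atMost_iff)
    also have "\<dots> \<le> C" unfolding C_def by (intro sum_mono2) auto
    finally show ?thesis by simp
  qed
  have ln: "filterlim (\<lambda>N. ln (real N)) at_top sequentially"
    using filterlim_compose[OF ln_at_top filterlim_real_sequentially] by simp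
  have lim: "(\<lambda>N. C / ln (real N) + r / 4 * (harm N / ln (real N))) \<longlonglongrightarrow> 0 + r / 4 * 1"
    by (intro tendsto_add tendsto_mult tendsto_const harm_over_ln
        tendsto_divide_0[OF tendsto_const] filterlim_at_top_imp_at_infinity ln)
  have "0 + r / 4 * 1 < r" using r by simp
  with lim have "\<forall>\<^sub>F N in sequentially. C / ln (real N) + r / 4 * (harm N / ln (real N)) < r"
    by (rule order_tendstoD(2))
  moreover have "\<forall>\<^sub>F N::nat in sequentially. N \<ge> 2" by (rule eventually_ge_at_top)
  ultimately have "\<forall>\<^sub>F N in sequentially. norm ((\<Sum>n=1..N. e n / n) / ln N - 0) < r"
  proof eventually_elim
    case (elim N)
    then have "ln (real N) > 0" by simp
    then have "\<bar>\<Sum>n=1..N. e n / n\<bar> / ln N \<le> (C + r / 4 * harm N) / ln N"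
      using le by (intro divide_right_mono) auto
    then show ?case using elim \<open>ln (real N) > 0\<close> by (simp add: add_divide_distrib)
  qed
  then show "\<exists>no. \<forall>n\<ge>no. norm ((\<Sum>k=1..n. e k / k) / ln n - 0) < r"
    by (simp add: eventually_sequentially)
qed

lemma cesaro_imp_logarithmic_mean:
  assumes a: "cesaro a \<longlonglongrightarrow> k"
  shows "(\<lambda>N. (\<Sum>n=1..N. a n / n) / ln N) \<longlonglongrightarrow> k"
proof -
  \<comment> \<open>Summation by parts produces the mean of the terms before n, hence the shift. At
    n = 1 it is the mean over an empty range, which is 0.\<close>
  define e where "e = (\<lambda>n. cesaro a (n - 1))"
  have parts: "(\<Sum>n=1..N. a n / n) = cesaro a N + (\<Sum>n=1..N. e n / n)" for N
  proof (induction N)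
    case 0 show ?case by (simp add: cesaro_def)
  next
    case (Suc N)
    have s: "(\<Sum>n=1..N. a n) = cesaro a N * N" by (cases "N = 0") (simp_all add: cesaro_def)
    have "cesaro a (Suc N) = (cesaro a N * N + a (Suc N)) / Suc N"
      unfolding s[symmetric] by (simp add: cesaro_def)
    then have "cesaro a N + a (Suc N) / Suc N = cesaro a (Suc N) + cesaro a N / Suc N"
      by (simp add: field_simps)
    then show ?case using Suc by (simp add: e_def)
  qed
  have ln: "filterlim (\<lambda>N. ln (real N)) at_top sequentially"
    using filterlim_compose[OF ln_at_top filterlim_real_sequentially] by simp
  have "e \<longlonglongrightarrow> k" using a unfolding e_def by (subst filterlim_sequentially_Suc[symmetric]) simp
  then have "(\<lambda>n. e n - k) \<longlonglongrightarrow> 0" by (simp add: LIM_zero)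
  from harmonic_average_null[OF this]
  have "(\<lambda>N. cesaro a N / ln N + (\<Sum>n=1..N. (e n - k) / n) / ln N + k * (harm N / ln N)) \<longlonglongrightarrow> 0 + 0 + k * 1"
    by (intro tendsto_add tendsto_mult tendsto_const harm_over_ln
        tendsto_divide_0[OF a] filterlim_at_top_imp_at_infinity ln)
  moreover have "cesaro a N / ln N + (\<Sum>n=1..N. (e n - k) / n) / ln N + k * (harm N / ln N)
      = (\<Sum>n=1..N. a n / n) / ln N" for N
  proof -
    have "(\<Sum>n=1..N. (e n - k) / n) = (\<Sum>n=1..N. e n / n) - k * harm N"
      by (simp add: left_diff_distrib sum_subtractf harm_def sum_distrib_left divide_inverse)
    then show ?thesis unfolding parts by (simp add: add_divide_distrib diff_divide_distrib)
  qed
  ultimately show ?thesis by simp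
qed

section \<open>Sieve products over primes\<close>

text \<open>Induction on the set of primes: split off from each n its power of p, bound the sum over
  these powers by the full geometric series, and apply the induction hypothesis to the cofactors.
  For this \<open>F\<close> has to be an arbitrary finite set.\<close>

lemma sum_inverse_smooth_le_Euler_product:
  fixes P F :: "nat set"
  assumes "finite P" "\<And>p. p \<in> P \<Longrightarrow> prime p" "finite F"
    and "\<And>n p. n \<in> F \<Longrightarrow> n > 0 \<and> (prime p \<and> p dvd n \<longrightarrow> p \<in> P)"
  shows "(\<Sum>n\<in>F. 1 / real n) \<le> (\<Prod>p\<in>P. 1 / (1 - 1 / real p))"
  using assms
proof (induction P arbitrary: F rule: finite_induct)
  case empty
  have "n = 1" if "n \<in> F" for n
    using empty.prems(3)[OF that] prime_factor_nat[of n] by auto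
  then have "F \<subseteq> {1}" by blast
  then have "(\<Sum>n\<in>F. 1 / real n) \<le> (\<Sum>n\<in>{1}. 1 / real n)" by (intro sum_mono2) auto
  then show ?case by simp
next
  case (insert p P F)
  have p: "prime p" "p > 1" using insert.prems(1) prime_gt_1_nat by auto
  define e where "e = (\<lambda>n. multiplicity p n)"
  define c where "c = (\<lambda>n. n div p ^ e n)"
  have dec: "n = p ^ e n * c n" for n by (simp add: c_def e_def multiplicity_dvd)
  have ndvd: "\<not> p dvd c n" if "n \<in> F" for n
    unfolding c_def e_def using insert.prems(3)[OF that, of p] p(1)
    by (intro multiplicity_decompose) auto
  have c_smooth: "k > 0 \<and> (prime q \<and> q dvd k \<longrightarrow> q \<in> P)" if k: "k \<in> c ` F" for k q
  proof -
    obtain n where n: "n \<in> F" "k = c n" using k by blast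
    have kn: "k dvd n" using dec[of n] n(2) by (metis dvd_triv_right)
    have nF: "n > 0" "prime q \<and> q dvd n \<Longrightarrow> q \<in> insert p P" using insert.prems(3)[OF n(1)] by auto
    have "k > 0" using kn nF(1) by (rule dvd_pos_nat[rotated])
    moreover have "q \<in> P" if "prime q" "q dvd k"
    proof -
      have "q \<noteq> p" using ndvd[OF n(1)] n(2) that by auto
      then show ?thesis using nF(2) that kn dvd_trans by blast
    qed
    ultimately show ?thesis by blast
  qed
  define K where "K = Max (e ` F)"
  have eK: "e n \<le> K" if "n \<in> F" for n unfolding K_def using that insert.prems(2) by (intro Max_ge) auto
  \<comment> \<open>The pair of exponent and cofactor determines n, so the sum over \<open>F\<close>
    is part of a sum over a rectangle, which factors.\<close>
  have inj: "inj_on (\<lambda>n. (e n, c n)) F" by (rule inj_onI) (metis dec prod.inject)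
  have "(\<Sum>n\<in>F. 1 / real n) = (\<Sum>n\<in>F. (1 / real p) ^ e n * (1 / real (c n)))"
  proof (rule sum.cong)
    fix n
    have "real n = real p ^ e n * real (c n)" using arg_cong[OF dec[of n], of real] by simp
    then show "1 / real n = (1 / real p) ^ e n * (1 / real (c n))"
      by (simp add: power_one_over)
  qed simp
  also have "\<dots> = (\<Sum>(i, k)\<in>(\<lambda>n. (e n, c n)) ` F. (1 / real p) ^ i * (1 / real k))"
    by (subst sum.reindex[OF inj]) simp
  also have "\<dots> \<le> (\<Sum>(i, k)\<in>{..K} \<times> c ` F. (1 / real p) ^ i * (1 / real k))"
    using eK insert.prems(2) by (intro sum_mono2) auto
  also have "\<dots> = (\<Sum>i\<le>K. (1 / real p) ^ i) * (\<Sum>k\<in>c ` F. 1 / real k)"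
    by (simp only: sum_product sum.cartesian_product)
  also have "\<dots> \<le> 1 / (1 - 1 / real p) * (\<Prod>p\<in>P. 1 / (1 - 1 / real p))"
  proof (rule mult_mono)
    have "(\<Sum>i\<le>K. (1 / real p) ^ i) \<le> (\<Sum>i. (1 / real p) ^ i)"
      using p(2) by (intro sum_le_suminf summable_geometric) auto
    also have "\<dots> = 1 / (1 - 1 / real p)" using p(2) by (intro suminf_geometric) simp
    finally show "(\<Sum>i\<le>K. (1 / real p) ^ i) \<le> 1 / (1 - 1 / real p)" .
    show "(\<Sum>k\<in>c ` F. 1 / real k) \<le> (\<Prod>p\<in>P. 1 / (1 - 1 / real p))"
      using insert.prems c_smooth by (intro insert.IH) auto
    show "0 \<le> 1 / (1 - 1 / real p)" using p(2) by simp
  qed (simp add: sum_nonneg)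
  finally show ?case using insert.hyps by simp
qed

lemma harm_le_Euler_product: "harm N \<le> (\<Prod>p | prime p \<and> p \<le> N. 1 / (1 - 1 / real p))"
proof -
  have "harm N = (\<Sum>n\<in>{1..N}. 1 / real n)" by (simp add: harm_def divide_inverse)
  also have "\<dots> \<le> (\<Prod>p | prime p \<and> p \<le> N. 1 / (1 - 1 / real p))"
    by (rule sum_inverse_smooth_le_Euler_product) (auto dest: dvd_imp_le)
  finally show ?thesis .
qed

lemma prime_reciprocal_factor_pos:
  assumes "prime (p :: nat)" shows "0 < 1 - 1 / real p" "1 - 1 / real p \<le> 1"
  using prime_gt_1_nat[OF assms] by simp_all

text \<open>The harmonic numbers are unbounded and bounded by the Euler product, so the products of
  1 - 1/p over p up to x tend to 0. Removing the primes below Q only divides by the fixed positive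
  number \<open>C\<close>.\<close>

lemma sieve_product_small:
  fixes e :: real
  assumes "e > 0"
  shows "\<exists>x. (\<Prod>p | prime p \<and> Q \<le> p \<and> p \<le> x. 1 - 1 / real p) < e"
proof -
  let ?a = "\<lambda>p::nat. 1 - 1 / real p"
  define C where "C = (\<Prod>p | prime p \<and> p < Q. ?a p)"
  have C: "C > 0" unfolding C_def using prime_reciprocal_factor_pos by (intro prod_pos) auto
  have "filterlim (\<lambda>N. harm N :: real) at_top sequentially" by (rule harm_at_top)
  then have "\<forall>\<^sub>F N in sequentially. harm N > 1 / (e * C)"
    unfolding filterlim_at_top_dense by blast
  moreover have "\<forall>\<^sub>F N in sequentially. N \<ge> Q" by (rule eventually_ge_at_top)
  ultimately have "\<forall>\<^sub>F N in sequentially. harm N > 1 / (e * C) \<and> N \<ge> Q" by (rule eventually_conj)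
  then obtain x where x: "harm x > 1 / (e * C)" "x \<ge> Q"
    using eventually_happens[of _ sequentially] by auto
  define D where "D = (\<Prod>p | prime p \<and> Q \<le> p \<and> p \<le> x. ?a p)"
  have D: "D > 0" unfolding D_def using prime_reciprocal_factor_pos by (intro prod_pos) auto
  have split: "{p. prime p \<and> p \<le> x} = {p. prime p \<and> p < Q} \<union> {p. prime p \<and> Q \<le> p \<and> p \<le> x}"
    using x(2) by auto
  have "(\<Prod>p | prime p \<and> p \<le> x. ?a p) = C * D"
    unfolding split C_def D_def by (rule prod.union_disjoint) auto
  then have "(\<Prod>p | prime p \<and> p \<le> x. 1 / ?a p) = 1 / (C * D)"
    by (simp add: prod_dividef)
  then have "1 / (e * C) < 1 / (C * D)" using harm_le_Euler_product[of x] x(1) by simp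
  then have "C * D < e * C" using C D assms by (simp add: field_simps)
  then have "D < e" using C by simp
  then show ?thesis unfolding D_def by blast
qed

section \<open>Means of S-parts of Mersenne numbers\<close>

text \<open>The prime p(q) of the overview. The choice among the prime factors is immaterial: what
  matters is that 2 has order q modulo it.\<close>

definition mersenne_factor :: "nat \<Rightarrow> nat" where
  "mersenne_factor q = (SOME p. prime p \<and> p dvd 2 ^ q - 1)"

lemma mersenne_factor:
  assumes "prime q"
  shows "prime (mersenne_factor q)" "mersenne_factor q dvd 2 ^ q - 1"
proof -
  have "(2::nat) ^ 2 \<le> 2 ^ q" using prime_ge_2_nat[OF assms] by (intro power_increasing) auto
  then have "2 ^ q - 1 \<noteq> (1::nat)" by simp
  then have "\<exists>p. prime p \<and> p dvd 2 ^ q - (1::nat)" by (rule prime_factor_nat)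
  then have "prime (mersenne_factor q) \<and> mersenne_factor q dvd 2 ^ q - 1"
    unfolding mersenne_factor_def by (rule someI_ex)
  then show "prime (mersenne_factor q)" "mersenne_factor q dvd 2 ^ q - 1" by auto
qed

lemma dvd_mersenne_iff_ord:
  fixes p :: nat
  shows "p dvd 2 ^ n - 1 \<longleftrightarrow> ord p 2 dvd n"
proof -
  have "p dvd 2 ^ n - 1 \<longleftrightarrow> [2 ^ n = 1] (mod p)"
    by (simp add: cong_altdef_nat)
  also have "\<dots> \<longleftrightarrow> ord p 2 dvd n" by (rule ord_divides)
  finally show ?thesis .
qed

text \<open>The order divides the prime q, and it is not 1 because no prime divides 2^1 - 1.\<close>

lemma ord_mersenne_factor:
  assumes "prime q" shows "ord (mersenne_factor q) 2 = q"
proof -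
  have "ord (mersenne_factor q) 2 dvd q"
    using mersenne_factor(2)[OF assms] by (simp only: dvd_mersenne_iff_ord)
  moreover have "ord (mersenne_factor q) 2 \<noteq> 1"
  proof
    assume "ord (mersenne_factor q) 2 = 1"
    then have "mersenne_factor q dvd 2 ^ 1 - 1" unfolding dvd_mersenne_iff_ord by simp
    then have "mersenne_factor q = 1" by simp
    then show False using mersenne_factor(1)[OF assms] by simp
  qed
  ultimately show ?thesis using assms by (auto simp: prime_nat_iff)
qed

lemma mersenne_factor_dvd_iff:
  "prime q \<Longrightarrow> mersenne_factor q dvd 2 ^ n - 1 \<longleftrightarrow> q dvd n"
  by (simp only: dvd_mersenne_iff_ord ord_mersenne_factor)

lemma mersenne_pos: "n \<ge> 1 \<Longrightarrow> 0 < 2 ^ n - (1::nat)"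
  using one_less_power[of "2::nat" n] by simp

lemma mersenne_factor_odd:
  assumes "prime q" shows "coprime (mersenne_factor q) 2"
proof -
  have "ord (mersenne_factor q) 2 > 0" using assms by (simp add: ord_mersenne_factor prime_gt_0_nat)
  then show ?thesis by (simp add: ord_eq_0 coprime_commute)
qed

text \<open>By Fermat the order q of 2 modulo p divides p - 1.\<close>

lemma mersenne_factor_gt:
  assumes "prime q" shows "q < mersenne_factor q"
proof -
  let ?p = "mersenne_factor q"
  have "q dvd totient ?p"
    using order_divides_totient[OF mersenne_factor_odd[OF assms]] by (simp add: ord_mersenne_factor assms)
  then have "q dvd ?p - 1" using totient_prime[OF mersenne_factor(1)[OF assms]] by simp
  moreover have "?p > 1" using mersenne_factor(1)[OF assms] by (rule prime_gt_1_nat)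
  ultimately have "q \<le> ?p - 1" by (intro dvd_imp_le) auto
  then show ?thesis using \<open>?p > 1\<close> by linarith
qed

lemma inj_on_mersenne_factor: "inj_on mersenne_factor {q. prime q}"
  by (rule inj_onI) (metis mem_Collect_eq ord_mersenne_factor)

text \<open>For n >= 1 this is the p-adic absolute value of 2^n - 1 at p =
  \<open>mersenne_factor q\<close>; at n = 0 the convention for multiplicities in 0 makes it
  1.\<close>

definition local_weight :: "nat \<Rightarrow> nat \<Rightarrow> real" where
  "local_weight q n = 1 / real (mersenne_factor q) ^ multiplicity (mersenne_factor q) (2 ^ n - 1)"

lemma local_weight_pos:
  assumes "prime q" shows "0 < local_weight q n"
  using prime_gt_0_nat[OF mersenne_factor(1)[OF assms]] by (simp add: local_weight_def)

lemma local_weight_le_1: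
  assumes "prime q" shows "local_weight q n \<le> 1"
proof -
  have "1 \<le> real (mersenne_factor q)"
    using prime_ge_1_nat[OF mersenne_factor(1)[OF assms]] by simp
  then show ?thesis by (simp add: local_weight_def divide_le_eq_1 one_le_power)
qed

lemma local_weight_not_dvd:
  assumes "prime q" "\<not> q dvd n" shows "local_weight q n = 1"
proof -
  have "\<not> mersenne_factor q dvd 2 ^ n - 1" using assms by (simp only: mersenne_factor_dvd_iff) simp
  then have "multiplicity (mersenne_factor q) (2 ^ n - 1) = 0" by (rule not_dvd_imp_multiplicity_0)
  then show ?thesis by (simp add: local_weight_def)
qed

lemma local_weight_dvd:
  assumes q: "prime q" and n: "q dvd n" "n \<ge> 1" shows "local_weight q n \<le> 1 / real q"
proof -
  let ?p = "mersenne_factor q"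
  have "?p dvd 2 ^ n - 1" using n(1) by (simp only: mersenne_factor_dvd_iff[OF q])
  then have "multiplicity ?p (2 ^ n - 1) > 0"
    using mersenne_factor(1)[OF q] mersenne_pos[OF n(2)]
    by (subst prime_multiplicity_gt_zero_iff) auto
  then have "real ?p ^ 1 \<le> real ?p ^ multiplicity ?p (2 ^ n - 1)"
    using prime_ge_1_nat[OF mersenne_factor(1)[OF q]] by (intro power_increasing) auto
  moreover have "real q \<le> real ?p" using mersenne_factor_gt[OF q] by simp
  moreover have "0 < real q" using q prime_gt_0_nat by simp
  ultimately show ?thesis unfolding local_weight_def by (intro divide_left_mono) auto
qed

text \<open>The gcd truncates the p-part of x at p^J. If the multiplicity is at most J nothing is
  lost; otherwise both reciprocals lie between 0 and 1 / p^J.\<close>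

lemma inverse_gcd_prime_power_approx:
  fixes p x :: nat
  assumes p: "prime p" and x: "x > 0"
  shows "\<bar>1 / real p ^ multiplicity p x - 1 / real (gcd (p ^ J) x)\<bar> \<le> 1 / real p ^ J"
proof -
  define v where "v = multiplicity p x"
  have pp: "real p > 1" using prime_gt_1_nat[OF p] by simp
  obtain y where y: "x = p ^ v * y" "\<not> p dvd y"
    unfolding v_def
  proof (rule multiplicity_decompose'[of x p])
    show "x \<noteq> 0" "\<not> is_unit p" using x p by auto
  qed blast
  show ?thesis
  proof (cases "v \<le> J")
    case True
    have "coprime (p ^ (J - v)) y" using p y(2) by (simp add: prime_imp_coprime)
    then have "gcd (p ^ v * p ^ (J - v)) (p ^ v * y) = p ^ v"
      by (simp add: gcd_mult_distrib_nat[symmetric])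
    then have "gcd (p ^ J) x = p ^ v" using True y(1) by (simp flip: power_add)
    then show ?thesis by (simp add: v_def)
  next
    case False
    then have "p ^ J dvd x" unfolding y(1) by (intro dvd_mult2 le_imp_power_dvd) simp
    then have "gcd (p ^ J) x = p ^ J" by (simp add: gcd_nat.absorb1)
    moreover have "1 / real p ^ v \<le> 1 / real p ^ J"
      using pp False by (intro divide_left_mono power_increasing) auto
    moreover have "0 \<le> 1 / real p ^ v" using pp by simp
    ultimately show ?thesis unfolding v_def[symmetric] by (simp only: of_nat_power)
  qed
qed

text \<open>The truncation gcd(p^J, 2^n - 1) depends only on 2^n modulo p^J, which by Euler's
  theorem has period \<open>totient (p ^ J)\<close> in n.\<close>

lemma limit_periodic_local_weight:
  assumes q: "prime q" shows "limit_periodic (local_weight q)"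
  unfolding limit_periodic_def
proof (intro allI impI)
  fix e :: real assume e: "e > 0"
  let ?p = "mersenne_factor q"
  have p: "prime ?p" using mersenne_factor(1)[OF q] .
  have pp: "1 < real ?p" using prime_gt_1_nat[OF p] by simp
  obtain J where J: "1 / e < real ?p ^ J" using real_arch_pow[OF pp] by blast
  have eJ: "1 / real ?p ^ J \<le> e" using J e pp by (simp add: field_simps)
  let ?g = "\<lambda>n. 1 / real (gcd (?p ^ J) (2 ^ n - 1))"
  show "\<exists>g m. m > 0 \<and> (\<forall>n. g (n + m) = g n) \<and> (\<forall>n\<ge>1. \<bar>local_weight q n - g n\<bar> \<le> e)"
  proof (intro exI[of _ ?g] exI[of _ "totient (?p ^ J)"] conjI allI impI)
    show "totient (?p ^ J) > 0" using prime_gt_0_nat[OF p] by simp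
    show "?g (n + totient (?p ^ J)) = ?g n" for n
    proof -
      let ?t = "totient (?p ^ J)"
      have "coprime 2 (?p ^ J)" using mersenne_factor_odd[OF q] by (simp add: coprime_commute)
      then have "[2 ^ ?t = 1] (mod ?p ^ J)" by (rule euler_theorem)
      then have "[2 ^ n * 2 ^ ?t = 2 ^ n * 1] (mod ?p ^ J)" by (rule cong_scalar_left)
      \<comment> \<open>Adding 1 on both sides keeps the congruence clear of truncated subtraction
        until it can be cancelled.\<close>
      moreover have "2 ^ n * 2 ^ ?t = (2 ^ (n + ?t) - 1) + (1::nat)" "2 ^ n * 1 = (2 ^ n - 1) + (1::nat)"
        by (simp_all add: power_add)
      ultimately have "[(2 ^ (n + ?t) - 1) + 1 = (2 ^ n - 1) + (1::nat)] (mod ?p ^ J)" by simp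
      then have "[2 ^ (n + ?t) - 1 = 2 ^ n - (1::nat)] (mod ?p ^ J)"
        by (simp only: cong_add_rcancel_nat)
      then have "gcd (?p ^ J) (2 ^ (n + ?t) - 1) = gcd (?p ^ J) (2 ^ n - 1)"
        using cong_gcd_eq[of "2 ^ (n + ?t) - 1" "2 ^ n - 1" "?p ^ J"] by (simp add: gcd.commute)
      then show ?thesis by (simp only:)
    qed
    fix n :: nat assume "n \<ge> 1"
    then have "0 < 2 ^ n - (1::nat)" by (rule mersenne_pos)
    from inverse_gcd_prime_power_approx[OF p this, of J] eJ
    show "\<bar>local_weight q n - ?g n\<bar> \<le> e" unfolding local_weight_def by linarith
  qed
qed

text \<open>For \<open>n \<ge> 1\<close> the primes \<open>q > n\<close> do not divide \<open>n\<close> and would contribute the factor 1, so this is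
  \<open>\<bar>2^n - 1\<bar>\<^sub>S\<close> for \<open>S = mersenne_factor ` A\<close> even when \<open>A\<close> is infinite.\<close>
definition set_weight :: "nat set \<Rightarrow> nat \<Rightarrow> real" where
  "set_weight A n = (\<Prod>q\<in>A \<inter> {..n}. local_weight q n)"

lemma set_weight_pos: "A \<subseteq> {q. prime q} \<Longrightarrow> 0 < set_weight A n"
  unfolding set_weight_def using local_weight_pos by (intro prod_pos) auto

lemma set_weight_le_1: "A \<subseteq> {q. prime q} \<Longrightarrow> set_weight A n \<le> 1"
  unfolding set_weight_def using local_weight_pos local_weight_le_1
  by (intro prod_le_1) (auto intro: less_imp_le)

lemma set_weight_finite:
  assumes "finite A" "A \<subseteq> {q. prime q}" "n \<ge> 1"
  shows "set_weight A n = (\<Prod>q\<in>A. local_weight q n)"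
  unfolding set_weight_def
proof (rule prod.mono_neutral_left)
  show "\<forall>q\<in>A - A \<inter> {..n}. local_weight q n = 1"
  proof
    fix q assume "q \<in> A - A \<inter> {..n}"
    then have "prime q" "q > n" using assms by auto
    then show "local_weight q n = 1" using assms(3) by (auto intro!: local_weight_not_dvd dest: dvd_imp_le)
  qed
qed (use assms in auto)

lemma limit_periodic_set_weight:
  assumes "finite A" "A \<subseteq> {q. prime q}"
  shows "limit_periodic (set_weight A)"
proof -
  have "limit_periodic (\<lambda>n. \<Prod>q\<in>A. local_weight q n)"
  proof (rule conjunct1[OF limit_periodic_prod[OF assms(1)]])
    fix q n assume "q \<in> A"
    then have "prime q" using assms by auto
    then show "limit_periodic (local_weight q)" "\<bar>local_weight q n\<bar> \<le> 1"
      using limit_periodic_local_weight local_weight_pos[of q n] local_weight_le_1[of q n] by auto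
  qed
  then show ?thesis
    unfolding limit_periodic_def using set_weight_finite[OF assms] by simp
qed

text \<open>For finite sets of primes \<open>lim\<close> is a genuine limit, by limit
  periodicity.\<close>

definition mean_weight :: "nat set \<Rightarrow> real" where
  "mean_weight A = lim (cesaro (set_weight A))"

lemma mean_weight:
  assumes "finite A" "A \<subseteq> {q. prime q}"
  shows "cesaro (set_weight A) \<longlonglongrightarrow> mean_weight A"
  unfolding mean_weight_def
  using cesaro_limit_periodic_convergent[OF limit_periodic_set_weight[OF assms]]
  by (simp add: convergent_LIMSEQ_iff)

lemma mean_weight_empty: "mean_weight {} = 1"
proof -
  have "\<forall>\<^sub>F N in sequentially. 1 = cesaro (set_weight {}) N"
    by (intro eventually_sequentiallyI[of 1]) (simp add: set_weight_def[abs_def] cesaro_const)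
  then have "cesaro (set_weight {}) \<longlonglongrightarrow> 1" by (rule Lim_transform_eventually[OF tendsto_const])
  then show ?thesis using mean_weight[of "{}"] LIMSEQ_unique by blast
qed

section \<open>Comparison of means and the sieve bound\<close>

lemma count_multiples_le:
  assumes "q > 0"
  shows "(\<Sum>n=1..N. of_bool (q dvd n)) \<le> real N / real q"
proof -
  have sub: "{n \<in> {1..N}. q dvd n} \<subseteq> (\<lambda>k. q * k) ` {1..N div q}"
  proof
    fix n assume n: "n \<in> {n \<in> {1..N}. q dvd n}"
    then obtain k where k: "n = q * k" by auto
    have "k \<ge> 1" using n k by (cases k) auto
    moreover have "k \<le> N div q" using n k assms by (simp add: less_eq_div_iff_mult_less_eq mult.commute)
    ultimately show "n \<in> (\<lambda>k. q * k) ` {1..N div q}" using k by auto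
  qed
  have "card {n \<in> {1..N}. q dvd n} \<le> card ((\<lambda>k. q * k) ` {1..N div q})"
    using sub by (intro card_mono) auto
  also have "\<dots> \<le> N div q" using card_image_le[of "{1..N div q}" "\<lambda>k. q * k"] by simp
  finally have "real (card {n \<in> {1..N}. q dvd n}) \<le> real (N div q)" by simp
  also have "\<dots> \<le> real N / real q" by (rule of_nat_div_le_of_nat)
  also have "real (card {n \<in> {1..N}. q dvd n}) = (\<Sum>n=1..N. of_bool (q dvd n))"
    by (simp add: Int_def)
  finally show ?thesis .
qed

text \<open>The two weights, both in (0,1], can differ only if some q in B - A divides n, and then
  the right-hand side is at least 1. Such a q is at most N, so the cutoff loses none of
  them.\<close>

lemma set_weight_diff_le:
  assumes AB: "A \<subseteq> B" "B \<subseteq> {q. prime q}" and n: "1 \<le> n" "n \<le> N"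
  shows "\<bar>set_weight A n - set_weight B n\<bar> \<le> (\<Sum>q\<in>(B - A) \<inter> {..N}. of_bool (q dvd n))"
proof (cases "\<exists>q\<in>B - A. q dvd n")
  case True
  then obtain q where q: "q \<in> B - A" "q dvd n" by blast
  have "q \<le> N" using dvd_imp_le[OF q(2)] n by simp
  have "(1::real) = of_bool (q dvd n)" using q by simp
  also have "\<dots> \<le> (\<Sum>q\<in>(B - A) \<inter> {..N}. of_bool (q dvd n))"
    using q \<open>q \<le> N\<close> by (intro member_le_sum) auto
  finally have "1 \<le> (\<Sum>q\<in>(B - A) \<inter> {..N}. of_bool (q dvd n) :: real)" .
  moreover have "A \<subseteq> {q. prime q}" using AB by blast
  ultimately show ?thesis
    using set_weight_pos[of A n] set_weight_pos[OF AB(2), of n] set_weight_le_1[of A n] set_weight_le_1[OF AB(2), of n]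
    by (simp add: abs_le_iff)
next
  case False
  have "set_weight A n = set_weight B n"
    unfolding set_weight_def
  proof (rule prod.mono_neutral_left)
    show "\<forall>q\<in>B \<inter> {..n} - A \<inter> {..n}. local_weight q n = 1"
      using False AB(2) by (auto intro!: local_weight_not_dvd)
  qed (use AB in auto)
  then show ?thesis by (simp add: sum_nonneg)
qed

text \<open>Interchange the sums: each q divides at most N / q of the numbers up to N. Infinite B is
  allowed so that the whole greedy set can be compared with its finite stages.\<close>

lemma cesaro_set_weight_diff_le:
  assumes AB: "A \<subseteq> B" "B \<subseteq> {q. prime q}" and N: "N > 0"
  shows "\<bar>cesaro (set_weight A) N - cesaro (set_weight B) N\<bar> \<le> (\<Sum>q\<in>(B - A) \<inter> {..N}. 1 / real q)"
proof -
  let ?D = "(B - A) \<inter> {..N}"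
  have "\<bar>\<Sum>n=1..N. set_weight A n - set_weight B n\<bar> \<le> (\<Sum>n=1..N. \<bar>set_weight A n - set_weight B n\<bar>)"
    by (rule sum_abs)
  also have "\<dots> \<le> (\<Sum>n=1..N. \<Sum>q\<in>?D. of_bool (q dvd n))"
    using set_weight_diff_le[OF AB] by (intro sum_mono) simp
  also have "\<dots> = (\<Sum>q\<in>?D. \<Sum>n=1..N. of_bool (q dvd n))" by (rule sum.swap)
  also have "\<dots> \<le> (\<Sum>q\<in>?D. real N / real q)"
  proof (rule sum_mono)
    fix q assume "q \<in> ?D"
    then have "prime q" using AB(2) by auto
    then show "(\<Sum>n=1..N. of_bool (q dvd n)) \<le> real N / real q"
      using prime_gt_0_nat by (intro count_multiples_le) auto
  qed
  also have "\<dots> = (\<Sum>q\<in>?D. 1 / real q) * N" by (simp add: sum_distrib_right)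
  finally show ?thesis unfolding cesaro_diff unfolding cesaro_def using N by (simp add: pos_divide_le_eq)
qed

lemma mean_weight_insert_ge:
  assumes A: "finite A" "A \<subseteq> {q. prime q}" and q: "prime q"
  shows "mean_weight A \<le> mean_weight (insert q A) + 1 / real q"
proof -
  let ?B = "insert q A"
  have B: "finite ?B" "?B \<subseteq> {q. prime q}" using A q by auto
  have "cesaro (set_weight A) N \<le> cesaro (set_weight ?B) N + 1 / real q" if "N \<ge> 1" for N
  proof -
    have "(\<Sum>q\<in>(?B - A) \<inter> {..N}. 1 / real q) \<le> (\<Sum>q\<in>{q}. 1 / real q)"
      by (intro sum_mono2) auto
    moreover have "\<bar>cesaro (set_weight A) N - cesaro (set_weight ?B) N\<bar> \<le> (\<Sum>q\<in>(?B - A) \<inter> {..N}. 1 / real q)"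
      using B(2) that by (intro cesaro_set_weight_diff_le) auto
    ultimately show ?thesis by simp
  qed
  then show ?thesis
    by (intro LIMSEQ_le[OF mean_weight[OF A] tendsto_add[OF mean_weight[OF B] tendsto_const]] exI[of _ 1] allI impI)
qed

text \<open>The indicator has period m, the product of B, and over one period it counts the
  totatives of m. Its mean is therefore \<open>totient m / m\<close>.\<close>

lemma cesaro_sieve:
  fixes B :: "nat set"
  assumes B: "finite B" "B \<subseteq> {q. prime q}"
  shows "cesaro (\<lambda>n. of_bool (\<forall>q\<in>B. \<not> q dvd n)) \<longlonglongrightarrow> (\<Prod>q\<in>B. 1 - 1 / real q)"
proof -
  let ?h = "\<lambda>n. of_bool (\<forall>q\<in>B. \<not> q dvd n) :: real"
  define m where "m = \<Prod>B"
  have m: "m > 0" unfolding m_def using B prime_gt_0_nat by (intro prod_pos) auto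
  have dm: "q dvd m" if "q \<in> B" for q unfolding m_def using B that by (intro dvd_prodI) auto
  have pf: "prime_factors m = B"
  proof
    show "B \<subseteq> prime_factors m" using dm B(2) m by (simp add: prime_factors_dvd subset_iff)
    show "prime_factors m \<subseteq> B"
    proof
      fix p assume "p \<in> prime_factors m"
      then have p: "prime p" "p dvd m" by (auto simp: prime_factors_dvd)
      have "\<exists>q\<in>B. p dvd q"
        using prime_dvd_prod_iff[OF B(1) p(1), of "\<lambda>q. q"] p(2) by (simp add: m_def)
      then obtain q where q: "q \<in> B" "p dvd q" by (rule bexE)
      then have "prime q" using B(2) by (simp add: subset_iff)
      then have "p = q" using primes_dvd_imp_eq[OF p(1) _ q(2)] by simp
      then show "p \<in> B" using q(1) by simp
    qed
  qed
  have "cesaro ?h \<longlonglongrightarrow> (\<Sum>n=1..m. ?h n) / m"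
  proof (rule cesaro_periodic[OF m])
    fix n
    have "q dvd n + m \<longleftrightarrow> q dvd n" if "q \<in> B" for q
      using dm[OF that] by (simp add: dvd_add_left_iff)
    then show "?h (n + m) = ?h n" by simp
  qed
  also have "(\<Sum>n=1..m. ?h n) = real (card {n \<in> {1..m}. \<forall>q\<in>B. \<not> q dvd n})" by (simp add: Int_def)
  also have "{n \<in> {1..m}. \<forall>q\<in>B. \<not> q dvd n} = totatives m"
  proof -
    have eq: "(\<forall>q\<in>B. \<not> q dvd n) \<longleftrightarrow> coprime n m" for n
    proof
      assume L: "\<forall>q\<in>B. \<not> q dvd n"
      show "coprime n m"
      proof (rule ccontr)
        assume "\<not> coprime n m"
        then have "gcd n m \<noteq> 1" by (simp only: coprime_iff_gcd_eq_1 not_False_eq_True)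
        then have "\<exists>p. prime p \<and> p dvd gcd n m" by (rule prime_factor_nat)
        then obtain p where p: "prime p" "p dvd gcd n m" by (elim exE conjE)
        then have "p dvd n" "p dvd m" by simp_all
        then have "p \<in> prime_factors m" using m p(1) by (simp add: prime_factors_dvd)
        then have "p \<in> B" by (simp only: pf)
        then have "\<not> p dvd n" by (rule bspec[OF L])
        then show False using \<open>p dvd n\<close> by (rule notE)
      qed
    next
      assume R: "coprime n m"
      show "\<forall>q\<in>B. \<not> q dvd n"
      proof (intro ballI notI)
        fix q assume "q \<in> B" "q dvd n"
        then have "is_unit q" by (intro coprime_common_divisor[OF R _ dm])
        moreover have "prime q" using \<open>q \<in> B\<close> B(2) by (simp add: subset_iff)
        ultimately show False using not_prime_unit by simp
      qed
    qed
    show ?thesis unfolding totatives_def eq by (intro Collect_cong) auto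
  qed
  also have "real (card (totatives m)) / m = (\<Prod>q\<in>B. 1 - 1 / real q)"
    using totient_formula2[of m] m unfolding pf totient_def by simp
  finally show ?thesis .
qed

text \<open>If some q >= Q in A divides n, the weight is at most 1/q, hence at most 1/Q. The
  remaining n have weight at most 1, and their density is the sieve product.\<close>

lemma mean_weight_le_sieve:
  assumes A: "finite A" "A \<subseteq> {q. prime q}" and Q: "Q > 0"
  shows "mean_weight A \<le> (\<Prod>q\<in>{q \<in> A. Q \<le> q}. 1 - 1 / real q) + 1 / real Q"
proof -
  let ?B = "{q \<in> A. Q \<le> q}" let ?h = "\<lambda>n. of_bool (\<forall>q\<in>?B. \<not> q dvd n) :: real"
  have "set_weight A n \<le> ?h n + 1 / real Q" if "n \<ge> 1" for n
  proof (cases "\<forall>q\<in>?B. \<not> q dvd n")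
    case True
    then have "?h n = 1" by simp
    moreover have "0 \<le> 1 / real Q" by simp
    ultimately show ?thesis using set_weight_le_1[OF A(2), of n] by linarith
  next
    case False
    then obtain q where q: "q \<in> A" "Q \<le> q" "q dvd n" by blast
    then have "prime q" using A by auto
    have "set_weight A n = local_weight q n * (\<Prod>q\<in>A - {q}. local_weight q n)"
      unfolding set_weight_finite[OF A that] using A q by (intro prod.remove)
    also have "\<dots> \<le> local_weight q n * 1"
    proof (rule mult_left_mono)
      show "(\<Prod>q\<in>A - {q}. local_weight q n) \<le> 1"
        using A local_weight_pos local_weight_le_1 by (intro prod_le_1) (auto intro: less_imp_le)
      show "0 \<le> local_weight q n" using local_weight_pos[OF \<open>prime q\<close>] by (rule less_imp_le)
    qed
    also have "\<dots> \<le> 1 / real q" using local_weight_dvd[OF \<open>prime q\<close> q(3) that] by simp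
    also have "\<dots> \<le> 1 / real Q" using q Q by (intro divide_left_mono) auto
    finally show ?thesis by (simp add: False)
  qed
  then have le: "cesaro (set_weight A) N \<le> cesaro (\<lambda>n. ?h n + 1 / real Q) N" for N
    by (rule cesaro_mono)
  have "cesaro (\<lambda>n. ?h n + 1 / real Q) N = cesaro ?h N + 1 / real Q" if "N \<ge> 1" for N
    using that by (simp add: cesaro_def sum.distrib add_divide_distrib)
  then have "cesaro (set_weight A) N \<le> cesaro ?h N + 1 / real Q" if "N \<ge> 1" for N
    using le[of N] that by simp
  moreover have "cesaro ?h \<longlonglongrightarrow> (\<Prod>q\<in>?B. 1 - 1 / real q)" using A by (intro cesaro_sieve) auto
  ultimately show ?thesis
    by (intro LIMSEQ_le[OF mean_weight[OF A] tendsto_add[OF _ tendsto_const]] exI[of _ 1] allI impI)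
qed

section \<open>The greedy set\<close>

text \<open>Stage j has decided about all primes below j. The strict inequality in the test
  preserves the invariant that the mean exceeds k.\<close>

fun greedy_stage :: "real \<Rightarrow> nat \<Rightarrow> nat set" where
  "greedy_stage k 0 = {}"
| "greedy_stage k (Suc j) =
     (if prime j \<and> mean_weight (insert j (greedy_stage k j)) > k
      then insert j (greedy_stage k j) else greedy_stage k j)"

definition greedy_set :: "real \<Rightarrow> nat set" where
  "greedy_set k = (\<Union>j. greedy_stage k j)"

lemma greedy_stage_finite: "finite (greedy_stage k j)"
  by (induction j) auto

lemma greedy_stage_prime: "greedy_stage k j \<subseteq> {q. prime q}"
  by (induction j) auto

lemma greedy_stage_less: "q \<in> greedy_stage k j \<Longrightarrow> q < j"
  by (induction j) (auto split: if_splits intro: less_SucI)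

lemma greedy_stage_mono: "i \<le> j \<Longrightarrow> greedy_stage k i \<subseteq> greedy_stage k j"
proof (induction j rule: dec_induct)
  case (step j)
  have "greedy_stage k j \<subseteq> greedy_stage k (Suc j)" by auto
  with step.IH show ?case by (rule subset_trans)
qed simp

lemma mean_weight_greedy_stage:
  assumes "k < 1" shows "mean_weight (greedy_stage k j) > k"
  by (induction j) (use assms in \<open>auto simp: mean_weight_empty\<close>)

lemma greedy_stage_eq: "greedy_stage k j = greedy_set k \<inter> {..<j}"
proof
  show "greedy_stage k j \<subseteq> greedy_set k \<inter> {..<j}"
    using greedy_stage_less by (auto simp: greedy_set_def)
  show "greedy_set k \<inter> {..<j} \<subseteq> greedy_stage k j"
  proof
    fix q assume "q \<in> greedy_set k \<inter> {..<j}"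
    then obtain i where q: "q \<in> greedy_stage k i" "q < j" by (auto simp: greedy_set_def)
    have stable: "q \<in> greedy_stage k i \<Longrightarrow> q < i \<Longrightarrow> q \<in> greedy_stage k (Suc q)" for i
    proof (induction i)
      case (Suc i)
      then show ?case by (cases "q = i") (auto split: if_splits)
    qed simp
    have "q \<in> greedy_stage k (Suc q)" using stable[OF q(1) greedy_stage_less[OF q(1)]] .
    then show "q \<in> greedy_stage k j" using greedy_stage_mono[of "Suc q" j k] q(2) by auto
  qed
qed

lemma greedy_set_prime: "greedy_set k \<subseteq> {q. prime q}"
  using greedy_stage_prime by (auto simp: greedy_set_def)

lemma greedy_set_not_mem:
  assumes "prime q" "q \<notin> greedy_set k"
  shows "mean_weight (insert q (greedy_stage k q)) \<le> k"
proof (rule ccontr)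
  assume "\<not> ?thesis"
  then have "q \<in> greedy_stage k (Suc q)" using assms(1) by simp
  then show False using assms(2) by (simp only: greedy_stage_eq) blast
qed

text \<open>The mean of every stage exceeds k, and the term 1/Q of the sieve bound takes up at most
  k / 2 of it.\<close>

lemma greedy_sieve_product_ge:
  assumes k: "k < 1" and Q: "Q > 0" "2 / k \<le> real Q" "k > 0"
  shows "k / 2 \<le> (\<Prod>q\<in>{q \<in> greedy_set k. Q \<le> q \<and> q < j}. 1 - 1 / real q)"
proof -
  have "{q \<in> greedy_stage k j. Q \<le> q} = {q \<in> greedy_set k. Q \<le> q \<and> q < j}"
    unfolding greedy_stage_eq by auto
  then have "mean_weight (greedy_stage k j)
      \<le> (\<Prod>q\<in>{q \<in> greedy_set k. Q \<le> q \<and> q < j}. 1 - 1 / real q) + 1 / real Q"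
    using mean_weight_le_sieve[OF greedy_stage_finite greedy_stage_prime Q(1), of k j] by simp
  moreover have "1 / real Q \<le> k / 2" using Q by (simp add: field_simps)
  ultimately show ?thesis using mean_weight_greedy_stage[OF k, of j] by linarith
qed

text \<open>With only finitely many refusals the greedy set would contain all primes from some Q on,
  and the sieve products would tend to 0 against the lower bound k / 2.\<close>

lemma infinite_primes_diff_greedy_set:
  assumes k: "0 < k" "k < 1"
  shows "infinite ({q. prime q} - greedy_set k)"
proof
  assume fin: "finite ({q. prime q} - greedy_set k)"
  obtain Q0 :: nat where Q0: "2 / k \<le> real Q0" using real_arch_simple by blast
  define Q where "Q = Suc (max Q0 (Max (insert 0 ({q. prime q} - greedy_set k))))"
  have mem: "q \<in> greedy_set k" if "prime q" "Q \<le> q" for q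
  proof (rule ccontr)
    assume "q \<notin> greedy_set k"
    then have "q \<le> Max (insert 0 ({q. prime q} - greedy_set k))" using fin that by (intro Max_ge) auto
    then show False using that(2) by (simp add: Q_def)
  qed
  have Q: "Q > 0" "2 / k \<le> real Q" using Q0 by (auto simp: Q_def)
  obtain x where x: "(\<Prod>p | prime p \<and> Q \<le> p \<and> p \<le> x. 1 - 1 / real p) < k / 2"
    using sieve_product_small[of "k / 2" Q] k by auto
  have "{q \<in> greedy_set k. Q \<le> q \<and> q < Suc x} = {p. prime p \<and> Q \<le> p \<and> p \<le> x}"
    using mem greedy_set_prime[of k] by auto
  then show False using greedy_sieve_product_ge[OF k(2) Q k(1), of "Suc x"] x by simp
qed

text \<open>The inequality 1 - x <= exp(-x) turns a lower bound for the product into an upper bound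
  for the sum.\<close>

lemma sum_reciprocals_le_ln_sieve:
  assumes "finite B" "B \<subseteq> {q. prime q}" "0 < c" "c \<le> (\<Prod>q\<in>B. 1 - 1 / real q)"
  shows "(\<Sum>q\<in>B. 1 / real q) \<le> ln (1 / c)"
proof -
  have "c \<le> (\<Prod>q\<in>B. exp (- (1 / real q)))"
  proof (rule order_trans[OF assms(4)], rule prod_mono)
    fix q assume "q \<in> B"
    then have "prime q" using assms(2) by auto
    then show "0 \<le> 1 - 1 / real q \<and> 1 - 1 / real q \<le> exp (- (1 / real q))"
      using prime_reciprocal_factor_pos(1)[of q] exp_ge_add_one_self[of "- (1 / real q)"] by simp
  qed
  also have "\<dots> = exp (- (\<Sum>q\<in>B. 1 / real q))" by (simp add: exp_sum[OF assms(1), symmetric] sum_negf)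
  finally have "ln c \<le> ln (exp (- (\<Sum>q\<in>B. 1 / real q)))" using assms(3) by (intro ln_mono) auto
  then show ?thesis using assms(3) by (simp add: ln_div)
qed

lemma summable_greedy_set:
  assumes k: "0 < k" "k < 1"
  shows "summable (\<lambda>q. if q \<in> greedy_set k then 1 / real q else 0)"
proof -
  obtain Q0 :: nat where Q0: "2 / k \<le> real Q0" using real_arch_simple by blast
  define Q where "Q = Suc Q0"
  have Q: "Q > 0" "2 / k \<le> real Q" using Q0 by (auto simp: Q_def)
  let ?f = "\<lambda>q. if q \<in> greedy_set k then 1 / real q else 0"
  show ?thesis
  proof (rule summableI_nonneg_bounded)
    fix n
    let ?B = "{q \<in> greedy_set k. Q \<le> q \<and> q < n}"
    have "sum ?f {..<n} \<le> sum ?f ({..<Q} \<union> {Q..<n})" by (intro sum_mono2) auto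
    also have "\<dots> = sum ?f {..<Q} + sum ?f {Q..<n}" by (intro sum.union_disjoint) auto
    also have "sum ?f {Q..<n} = (\<Sum>q\<in>{q \<in> {Q..<n}. q \<in> greedy_set k}. 1 / real q)"
      by (rule sum.inter_filter[symmetric]) simp
    also have "{q \<in> {Q..<n}. q \<in> greedy_set k} = ?B" by auto
    also have "(\<Sum>q\<in>?B. 1 / real q) \<le> ln (1 / (k / 2))"
    proof (rule sum_reciprocals_le_ln_sieve)
      show "k / 2 \<le> (\<Prod>q\<in>?B. 1 - 1 / real q)" by (rule greedy_sieve_product_ge[OF k(2) Q k(1)])
    qed (use k greedy_set_prime in auto)
    finally show "sum ?f {..<n} \<le> sum ?f {..<Q} + ln (1 / (k / 2))" by simp
  qed auto
qed

lemma greedy_set_tail: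
  assumes k: "0 < k" "k < 1" and e: "e > 0"
  shows "\<exists>J. \<forall>i\<ge>J. \<forall>N. (\<Sum>q\<in>(greedy_set k - greedy_stage k i) \<inter> {..N}. 1 / real q) < e"
proof -
  let ?f = "\<lambda>q. if q \<in> greedy_set k then 1 / real q else 0"
  obtain J where J: "\<And>m n. m \<ge> J \<Longrightarrow> norm (sum ?f {m..<n}) < e"
    using summable_greedy_set[OF k] e unfolding summable_Cauchy by meson
  have "(\<Sum>q\<in>(greedy_set k - greedy_stage k i) \<inter> {..N}. 1 / real q) < e" if "i \<ge> J" for i N
  proof -
    have "(greedy_set k - greedy_stage k i) \<inter> {..N} = {q \<in> {i..<Suc N}. q \<in> greedy_set k}"
      unfolding greedy_stage_eq by auto
    then have "(\<Sum>q\<in>(greedy_set k - greedy_stage k i) \<inter> {..N}. 1 / real q) = sum ?f {i..<Suc N}"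
      by (simp only: sum.inter_filter finite_atLeastLessThan)
    also have "\<dots> < e" using J[OF that, of "Suc N"] by simp
    finally show ?thesis .
  qed
  then show ?thesis by blast
qed

lemma unbounded_primes_not_greedy:
  assumes "0 < k" "k < 1"
  obtains q where "prime q" "q \<notin> greedy_set k" "q \<ge> J"
proof -
  have "\<not> ({q. prime q} - greedy_set k \<subseteq> {..<J})"
    using infinite_primes_diff_greedy_set[OF assms] finite_subset by blast
  then obtain q where "q \<in> {q. prime q} - greedy_set k" "q \<notin> {..<J}" by blast
  then show ?thesis by (intro that) auto
qed

text \<open>Stop at a refused prime q far out. The mean of that stage is within 1/q of k, the tail
  of the convergent reciprocal sum bounds the effect of all later primes uniformly in N, and the
  finite stage has its mean as a limit; each error is below r / 3.\<close>

lemma cesaro_greedy_set: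
  assumes k: "0 < k" "k < 1"
  shows "cesaro (set_weight (greedy_set k)) \<longlonglongrightarrow> k"
proof (rule LIMSEQ_I)
  fix r :: real assume r: "r > 0"
  then have r3: "r / 3 > 0" by simp
  obtain J where J: "\<forall>i\<ge>J. \<forall>N. (\<Sum>q\<in>(greedy_set k - greedy_stage k i) \<inter> {..N}. 1 / real q) < r / 3"
    using greedy_set_tail[OF k r3] by (rule exE)
  obtain K :: nat where K: "3 / r < real K" using reals_Archimedean2 by blast
  obtain q where q: "prime q" "q \<notin> greedy_set k" "q \<ge> max J K"
    using unbounded_primes_not_greedy[OF k] by blast
  let ?A = "greedy_stage k q"
  have "q > 0" using q(1) prime_gt_0_nat by simp
  moreover have "3 / r < real q" using K q(3) by simp
  ultimately have "1 / real q < r / 3" using r by (simp add: field_simps)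
  \<comment> \<open>Refusal means that with q the mean is at most k, and leaving q out raises it by
    at most 1/q.\<close>
  moreover have "mean_weight ?A \<le> k + 1 / real q"
    using mean_weight_insert_ge[OF greedy_stage_finite greedy_stage_prime q(1), of k q]
      greedy_set_not_mem[OF q(1,2)] by linarith
  moreover have "k < mean_weight ?A" by (rule mean_weight_greedy_stage[OF k(2)])
  ultimately have M: "\<bar>mean_weight ?A - k\<bar> < r / 3" by linarith
  obtain N0 where N0: "\<forall>N\<ge>N0. norm (cesaro (set_weight ?A) N - mean_weight ?A) < r / 3"
    using LIMSEQ_D[OF mean_weight[OF greedy_stage_finite greedy_stage_prime, of k q] r3] by (rule exE)
  show "\<exists>no. \<forall>N\<ge>no. norm (cesaro (set_weight (greedy_set k)) N - k) < r"
  proof (intro exI[of _ "Suc N0"] allI impI)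
    fix N assume N: "N \<ge> Suc N0"
    have "?A \<subseteq> greedy_set k" by (simp add: greedy_stage_eq)
    then have "\<bar>cesaro (set_weight ?A) N - cesaro (set_weight (greedy_set k)) N\<bar>
        \<le> (\<Sum>q\<in>(greedy_set k - ?A) \<inter> {..N}. 1 / real q)"
      using N by (intro cesaro_set_weight_diff_le greedy_set_prime) auto
    also have "\<dots> < r / 3" using J q(3) by simp
    finally have "\<bar>cesaro (set_weight ?A) N - cesaro (set_weight (greedy_set k)) N\<bar> < r / 3" .
    moreover have "\<bar>cesaro (set_weight ?A) N - mean_weight ?A\<bar> < r / 3" using N0 N by simp
    ultimately show "norm (cesaro (set_weight (greedy_set k)) N - k) < r" using M
      unfolding real_norm_def by linarith
  qed
qed

text \<open>A finite greedy set would have mean k + d with d > 0; a large prime q with 1/q < d could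
  then be added and the mean would stay above k, so q would not have been refused.\<close>

lemma infinite_greedy_set:
  assumes k: "0 < k" "k < 1" shows "infinite (greedy_set k)"
proof
  assume fin: "finite (greedy_set k)"
  define J where "J = Suc (Max (insert 0 (greedy_set k)))"
  have stage: "greedy_stage k j = greedy_set k" if "j \<ge> J" for j
  proof -
    have "q < j" if "q \<in> greedy_set k" for q
    proof -
      have "q \<le> Max (insert 0 (greedy_set k))" using fin that by (intro Max_ge) auto
      then show ?thesis using \<open>j \<ge> J\<close> unfolding J_def by linarith
    qed
    then show ?thesis unfolding greedy_stage_eq by auto
  qed
  define d where "d = mean_weight (greedy_set k) - k"
  have d: "d > 0" using mean_weight_greedy_stage[OF k(2), of J] stage[of J] by (simp add: d_def)
  obtain K :: nat where K: "1 / d < real K" using reals_Archimedean2 by blast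
  obtain q where q: "prime q" "q \<notin> greedy_set k" "q \<ge> max J K"
    using unbounded_primes_not_greedy[OF k] by blast
  have "q > 0" using q(1) prime_gt_0_nat by simp
  moreover have "1 / d < real q" using K q(3) by simp
  ultimately have "1 / real q < d" using d by (simp add: field_simps)
  moreover have "mean_weight (greedy_set k) \<le> k + 1 / real q"
    using mean_weight_insert_ge[OF greedy_stage_finite greedy_stage_prime q(1), of k q]
      greedy_set_not_mem[OF q(1,2)] stage[of q] q(3) by simp
  ultimately show False by (simp add: d_def)
qed

section \<open>Asymptotics of the Mertens sum\<close>

text \<open>Here s is the S-part of 2^n - 1 and m the cofactor prime to S, which will be the number
  of fixed points of the n-th iterate.\<close>

lemma mersenne_S_part:
  assumes A: "A \<subseteq> {q. prime q}" and n: "n \<ge> 1" and S: "S = mersenne_factor ` A"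
  shows "\<exists>m s. S_number S s \<and> (\<forall>b. S_number S b \<longrightarrow> coprime m b) \<and> m > 0 \<and>
    2 ^ n - 1 = m * s \<and> real m = (2 ^ n - 1) * set_weight A n"
proof -
  define x where "x = (2 ^ n - 1 :: nat)"
  have x: "x > 0" unfolding x_def using n by (rule mersenne_pos)
  \<comment> \<open>The finitely many primes in \<open>D\<close> suffice: p(q) divides 2^n - 1 only
    if q divides n, which forces q <= n.\<close>
  define D where "D = mersenne_factor ` (A \<inter> {..n})"
  define s where "s = (\<Prod>p\<in>D. p ^ multiplicity p x)"
  have D: "finite D" "\<And>p. p \<in> D \<Longrightarrow> prime p" "D \<subseteq> S"
    unfolding D_def S using mersenne_factor(1) A by auto
  have mult_s: "multiplicity p s = (if p \<in> D then multiplicity p x else 0)" if "prime p" for p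
    unfolding s_def using D(1,2) that by (rule multiplicity_prod_prime_powers)
  have s0: "s > 0" unfolding s_def using D(2) prime_gt_0_nat by (intro prod_pos) auto
  have "s dvd x" using s0 mult_s by (intro multiplicity_le_imp_dvd) auto
  then obtain m where m: "x = m * s" by (metis dvdE mult.commute)
  have m0: "m > 0" using x m by (cases m) auto
  have sum: "multiplicity p x = multiplicity p m + multiplicity p s" if "prime p" for p
    unfolding m using that m0 s0 by (intro prime_elem_multiplicity_mult_distrib) auto
  have "S_number S s"
    unfolding S_number_def
  proof (intro conjI allI impI)
    fix p assume p: "prime p \<and> p dvd s"
    then have "multiplicity p s > 0" using s0 by (simp add: prime_multiplicity_gt_zero_iff)
    then have "p \<in> D" using mult_s[of p] p by (simp split: if_splits)
    then show "p \<in> S" using D(3) by blast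
  qed (rule s0)
  moreover have "coprime m b" if b: "S_number S b" for b
  proof (rule ccontr)
    assume "\<not> coprime m b"
    then have "gcd m b \<noteq> 1" by (simp only: coprime_iff_gcd_eq_1 not_False_eq_True)
    then have "\<exists>p. prime p \<and> p dvd gcd m b" by (rule prime_factor_nat)
    then obtain p where p: "prime p" "p dvd m" "p dvd b" by auto
    have "p \<in> S" using b p by (auto simp: S_number_def)
    then obtain q where q: "q \<in> A" "p = mersenne_factor q" unfolding S by blast
    have "prime q" using q(1) A by auto
    have "p dvd x" using p(2) m by simp
    then have "q dvd n" unfolding x_def q(2) using \<open>prime q\<close> by (simp only: mersenne_factor_dvd_iff)
    then have "q \<le> n" using n by (intro dvd_imp_le) auto
    then have "p \<in> D" unfolding D_def using q by blast
    then have "multiplicity p m = 0" using sum[OF p(1)] mult_s[OF p(1)] by simp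
    then show False using p m0 prime_multiplicity_gt_zero_iff[of p m] by simp
  qed
  moreover have "real m = (2 ^ n - 1) * set_weight A n"
  proof -
    have "inj_on mersenne_factor (A \<inter> {..n})"
      using inj_on_mersenne_factor by (rule inj_on_subset) (use A in auto)
    then have "set_weight A n = (\<Prod>p\<in>D. 1 / real p ^ multiplicity p x)"
      unfolding D_def set_weight_def local_weight_def x_def by (subst prod.reindex) (simp_all add: o_def)
    also have "\<dots> = 1 / real s" by (simp add: s_def prod_dividef)
    finally have w: "set_weight A n = 1 / real s" .
    have "real m * real s = 2 ^ n - 1"
      using arg_cong[OF m, of real] unfolding x_def by (simp add: of_nat_diff)
    then show ?thesis using s0 unfolding w by (simp add: eq_divide_eq)
  qed
  ultimately show ?thesis using m0 m unfolding x_def by (intro exI[of _ m] exI[of _ s]) simp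
qed

lemma periodic_point_count:
  assumes A: "A \<subseteq> {q. prime q}" and n: "n \<ge> 1" and S: "S = mersenne_factor ` A"
  shows "finite {\<xi> \<in> S_dual S. (S_integer_map S ^^ n) \<xi> = \<xi>}"
    and "real (card {\<xi> \<in> S_dual S. (S_integer_map S ^^ n) \<xi> = \<xi>}) = (2 ^ n - 1) * set_weight A n"
proof -
  obtain m s where s: "S_number S s" "2 ^ n - 1 = m * s" and cop: "\<forall>b. S_number S b \<longrightarrow> coprime m b"
    and m: "m > 0" and w: "real m = (2 ^ n - 1) * set_weight A n"
    using mersenne_S_part[OF A n S] by (elim exE conjE)
  show "finite {\<xi> \<in> S_dual S. (S_integer_map S ^^ n) \<xi> = \<xi>}"
    by (rule card_periodic_characters(1)[OF _ m s]) (simp add: cop)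
  have "card {\<xi> \<in> S_dual S. (S_integer_map S ^^ n) \<xi> = \<xi>} = m"
    by (rule card_periodic_characters(2)[OF _ m s]) (simp add: cop)
  with w show "real (card {\<xi> \<in> S_dual S. (S_integer_map S ^^ n) \<xi> = \<xi>}) = (2 ^ n - 1) * set_weight A n"
    by (simp only:)
qed

text \<open>The number of points on closed orbits of length n relative to 2^n. With this scaling
  \<open>mertens_sum\<close> becomes the sum of \<open>orbit_density S n / n\<close>.\<close>

definition orbit_density :: "nat set \<Rightarrow> nat \<Rightarrow> real" where
  "orbit_density S n = real n * real (card {\<tau>. closed_orbit (S_dual S) (S_integer_map S) n \<tau>}) / 2 ^ n"

text \<open>Points on closed orbits of length n are among the fixed points of the n-th iterate, and
  those missing have period at most n / 2, so there are at most 2 * 2^(n div 2) of them. The -1 in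
  2^n - 1 is absorbed in a third such term, and 3 * 2^(n div 2) / 2^n is at most 6 / n.\<close>

lemma orbit_density_approx:
  assumes A: "A \<subseteq> {q. prime q}" and n: "n \<ge> 1" and S: "S = mersenne_factor ` A"
  shows "\<bar>orbit_density S n - set_weight A n\<bar> \<le> 6 / real n"
proof -
  let ?P = "\<lambda>n. {\<xi> \<in> S_dual S. (S_integer_map S ^^ n) \<xi> = \<xi>}"
  let ?O = "{\<tau>. closed_orbit (S_dual S) (S_integer_map S) n \<tau>}"
  let ?w = "set_weight A n"
  note T = S_integer_map_in_S_dual
  have w: "0 \<le> ?w" "?w \<le> 1" using set_weight_pos[OF A, of n] set_weight_le_1[OF A, of n] by auto
  have fin: "finite (?P d)" if "d > 0" for d using periodic_point_count(1)[OF A _ S, of d] that by simp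
  have cardP: "real (card (?P d)) \<le> 2 ^ d" if "d \<ge> 1" for d
  proof -
    have "(2 ^ d - 1) * set_weight A d \<le> (2 ^ d - 1) * (1::real)"
      using set_weight_le_1[OF A] by (intro mult_left_mono) auto
    then show ?thesis using periodic_point_count(2)[OF A that S] by simp
  qed
  have n0: "n > 0" using n by simp
  have "n * card ?O \<le> card (?P n)"
    using card_closed_orbits(2,3)[of "S_dual S" "S_integer_map S", OF T fin[OF n0] n0]
      card_mono[OF fin[OF n0], of "\<Union>?O"] by simp
  then have "real n * real (card ?O) \<le> real (card (?P n))" by (simp only: of_nat_le_iff flip: of_nat_mult)
  then have upper: "real n * real (card ?O) \<le> 2 ^ n * ?w"
    using periodic_point_count(2)[OF A n S] w(1) by (simp add: left_diff_distrib)
  have "card (?P n) \<le> n * card ?O + (\<Sum>d=1..n div 2. card (?P d))"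
    using T fin n0 by (rule periodic_points_le_closed_orbits)
  then have "real (card (?P n)) \<le> real (n * card ?O + (\<Sum>d=1..n div 2. card (?P d)))"
    by (rule of_nat_mono)
  also have "\<dots> = real n * real (card ?O) + (\<Sum>d=1..n div 2. real (card (?P d)))" by simp
  also have "(\<Sum>d=1..n div 2. real (card (?P d))) \<le> (\<Sum>d=1..n div 2. 2 ^ d)"
    using cardP by (intro sum_mono) auto
  also have "(\<Sum>d=1..n div 2. 2 ^ d) \<le> (2::real) * 2 ^ (n div 2)"
  proof -
    have "(\<Sum>d=1..k. 2 ^ d) \<le> (2::real) * 2 ^ k" for k by (induction k) auto
    then show ?thesis .
  qed
  finally have "(2 ^ n - 1) * ?w \<le> real n * real (card ?O) + 2 * 2 ^ (n div 2)"
    using periodic_point_count(2)[OF A n S] by simp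
  then have "2 ^ n * ?w \<le> real n * real (card ?O) + 2 * 2 ^ (n div 2) + 1"
    using w by (simp add: left_diff_distrib)
  also have "\<dots> \<le> real n * real (card ?O) + 3 * 2 ^ (n div 2)"
    using one_le_power[of "2::real" "n div 2"] by simp
  finally have lower: "2 ^ n * ?w \<le> real n * real (card ?O) + 3 * 2 ^ (n div 2)" .
  have "orbit_density S n \<le> ?w"
    using upper unfolding orbit_density_def by (simp add: divide_le_eq mult.commute)
  moreover have "?w \<le> orbit_density S n + 3 * 2 ^ (n div 2) / 2 ^ n"
    using lower unfolding orbit_density_def by (simp add: field_simps)
  moreover have "3 * 2 ^ (n div 2) / 2 ^ n \<le> 6 / real n"
  proof -
    have "n div 2 + 1 \<le> 2 ^ (n div 2)" using less_exp[of "n div 2"] by linarith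
    then have "n \<le> 2 * 2 ^ (n div 2)" by linarith
    then have "real n \<le> real (2 * 2 ^ (n div 2))" by (rule of_nat_mono)
    then have "real n * 2 ^ (n div 2) \<le> 2 * 2 ^ (n div 2) * 2 ^ (n div 2)"
      by (intro mult_right_mono) auto
    also have "\<dots> = (2::real) * 2 ^ (n div 2 + n div 2)" by (simp add: power_add)
    also have "\<dots> \<le> 2 * 2 ^ n" by (intro mult_left_mono power_increasing) auto
    finally show ?thesis using n0 by (simp add: field_simps)
  qed
  ultimately show ?thesis by linarith
qed

text \<open>Group the orbits by length, which is their cardinality, so the groups are disjoint. As
  the entropy is ln 2, an orbit of length n contributes 2^(-n).\<close>

lemma mertens_sum_eq:
  assumes A: "A \<subseteq> {q. prime q}" and S: "S = mersenne_factor ` A"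
  shows "mertens_sum S N = (\<Sum>n=1..N. orbit_density S n / real n)"
proof -
  let ?C = "closed_orbit (S_dual S) (S_integer_map S)"
  note T = S_integer_map_in_S_dual
  have card: "card \<tau> = n" if "?C n \<tau>" for n \<tau> using that by (auto simp: closed_orbit_def)
  have fin: "finite {\<tau>. ?C n \<tau>}" if "n \<ge> 1" for n
    using card_closed_orbits(1)[of "S_dual S" "S_integer_map S" n, OF T periodic_point_count(1)[OF A that S]] that
    by simp
  have pos: "n \<ge> 1" if "?C n \<tau>" for n \<tau>
  proof -
    have "\<tau> \<noteq> {}" "finite \<tau>" using that by (auto simp: closed_orbit_def)
    then have "card \<tau> > 0" by (simp add: card_gt_0_iff)
    then show ?thesis using card[OF that] by simp
  qed
  have set: "{\<tau>. \<exists>n\<le>N. ?C n \<tau>} = (\<Union>n\<in>{1..N}. {\<tau>. ?C n \<tau>})"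
  proof (intro equalityI subsetI)
    fix \<tau> assume "\<tau> \<in> {\<tau>. \<exists>n\<le>N. ?C n \<tau>}"
    then obtain n where "n \<le> N" "?C n \<tau>" by blast
    with pos[OF this(2)] show "\<tau> \<in> (\<Union>n\<in>{1..N}. {\<tau>. ?C n \<tau>})" by (intro UN_I[of n]) auto
  qed auto
  have "mertens_sum S N = (\<Sum>\<tau>\<in>(\<Union>n\<in>{1..N}. {\<tau>. ?C n \<tau>}). exp (- ln 2 * real (card \<tau>)))"
    by (simp add: mertens_sum_def Let_def topological_entropy_S_integer_map set)
  also have "\<dots> = (\<Sum>n=1..N. \<Sum>\<tau>\<in>{\<tau>. ?C n \<tau>}. exp (- ln 2 * real (card \<tau>)))"
  proof (rule sum.UNION_disjoint)
    show "\<forall>i\<in>{1..N}. \<forall>j\<in>{1..N}. i \<noteq> j \<longrightarrow> {\<tau>. ?C i \<tau>} \<inter> {\<tau>. ?C j \<tau>} = {}"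
      using card by blast
  qed (use fin in auto)
  also have "\<dots> = (\<Sum>n=1..N. orbit_density S n / real n)"
  proof (rule sum.cong)
    fix n assume n: "n \<in> {1..N}"
    have "(\<Sum>\<tau>\<in>{\<tau>. ?C n \<tau>}. exp (- ln 2 * real (card \<tau>))) = (\<Sum>\<tau>\<in>{\<tau>. ?C n \<tau>}. 1 / 2 ^ n)"
    proof (rule sum.cong)
      fix \<tau> assume "\<tau> \<in> {\<tau>. ?C n \<tau>}"
      then have "card \<tau> = n" using card by simp
      moreover have "exp (real n * ln 2) = (2::real) ^ n" by (simp add: exp_of_nat_mult)
      ultimately show "exp (- ln 2 * real (card \<tau>)) = 1 / 2 ^ n"
        by (simp add: exp_minus mult.commute inverse_eq_divide)
    qed simp
    then show "(\<Sum>\<tau>\<in>{\<tau>. ?C n \<tau>}. exp (- ln 2 * real (card \<tau>))) = orbit_density S n / real n"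
      using n by (simp add: orbit_density_def)
  qed simp
  finally show ?thesis .
qed

theorem theorem2:
  fixes k :: real
  assumes "0 < k" and "k < 1"
  shows "\<exists>S :: nat set. S \<subseteq> {p. prime p} \<and> infinite S \<and> infinite ({p. prime p} - S) \<and>
           (\<lambda>N :: nat. mertens_sum S N) \<sim>[at_top] (\<lambda>N. k * ln (real N))"
proof -
  define A where "A = greedy_set k"
  define S where "S = mersenne_factor ` A"
  have A: "A \<subseteq> {q. prime q}" unfolding A_def by (rule greedy_set_prime)
  have inj: "inj_on mersenne_factor B" if "B \<subseteq> {q. prime q}" for B
    using inj_on_mersenne_factor that by (rule inj_on_subset)
  have "S \<subseteq> {p. prime p}" unfolding S_def using mersenne_factor(1) A by auto
  moreover have "infinite S"
    unfolding S_def finite_image_iff[OF inj[OF A]] unfolding A_def by (rule infinite_greedy_set[OF assms])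
  moreover have "infinite ({p. prime p} - S)"
  proof
    assume fin: "finite ({p. prime p} - S)"
    \<comment> \<open>Each refused prime q yields a prime p(q) outside S, because
      \<open>mersenne_factor\<close> is injective on primes.\<close>
    have "mersenne_factor ` ({q. prime q} - A) \<subseteq> {p. prime p} - S"
    proof
      fix p assume "p \<in> mersenne_factor ` ({q. prime q} - A)"
      then obtain q where q: "prime q" "q \<notin> A" "p = mersenne_factor q" by blast
      have "p \<notin> S"
      proof
        assume "p \<in> S"
        then obtain q' where q': "q' \<in> A" "p = mersenne_factor q'" unfolding S_def by blast
        have "mersenne_factor q = mersenne_factor q'" using q(3) q'(2) by (simp only:)
        then have "q = q'" using q(1) q'(1) A by (subst (asm) inj_on_eq_iff[OF inj_on_mersenne_factor]) auto
        then show False using q(2) q'(1) by blast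
      qed
      then show "p \<in> {p. prime p} - S" using q mersenne_factor(1) by simp
    qed
    then have "finite (mersenne_factor ` ({q. prime q} - A))" using fin by (rule finite_subset)
    then have "finite ({q. prime q} - A)"
      using finite_image_iff[OF inj[of "{q. prime q} - A"]] by simp
    then show False using infinite_primes_diff_greedy_set[OF assms] by (simp add: A_def)
  qed
  moreover have "(\<lambda>N. mertens_sum S N) \<sim>[at_top] (\<lambda>N. k * ln (real N))"
  proof (rule asymp_equivI'_const)
    have "(\<lambda>n. orbit_density S n - set_weight A n) \<longlonglongrightarrow> 0"
    proof (rule Lim_null_comparison)
      show "\<forall>\<^sub>F n in sequentially. norm (orbit_density S n - set_weight A n) \<le> 6 / real n"
        using orbit_density_approx[OF A _ S_def] by (intro eventually_sequentiallyI[of 1]) simp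
      show "(\<lambda>n. 6 / real n) \<longlonglongrightarrow> 0" by (rule lim_const_over_n)
    qed
    from harmonic_average_null[OF this]
      cesaro_imp_logarithmic_mean[OF cesaro_greedy_set[OF assms]]
    have "(\<lambda>N. (\<Sum>n=1..N. (orbit_density S n - set_weight A n) / n) / ln N
        + (\<Sum>n=1..N. set_weight A n / n) / ln N) \<longlonglongrightarrow> 0 + k"
      unfolding A_def by (rule tendsto_add)
    \<comment> \<open>The Mertens sum splits into the logarithmic sum of the weights, which produces
      k, and that of a null sequence.\<close>
    moreover have eq: "(\<Sum>n=1..N. (orbit_density S n - set_weight A n) / n) / ln N
        + (\<Sum>n=1..N. set_weight A n / n) / ln N = mertens_sum S N / ln (real N)" for N
      unfolding mertens_sum_eq[OF A S_def]
      by (simp add: diff_divide_distrib sum_subtractf)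
    ultimately show "(\<lambda>N. mertens_sum S N / ln (real N)) \<longlonglongrightarrow> k" unfolding eq by (simp only: add_0)
    show "k \<noteq> 0" using assms by simp
  qed
  ultimately show ?thesis by blast
qed

end
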